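(* Let $0<\alpha<1$. If $$\sum_n 2^{-(1-\alpha)n}N_{n}<\infty,$$ then $\mu_{\Lambda}=\sum_{\lambda\in\Lambda(\omega)}(1-|\lambda|^2)^{1-\alpha}\delta_{\lambda}$ is almost surely a Carleson measure for $\mathcal{D}_\alpha$.
   Context: $\mathbb{D}$ is the open unit disk. Random sequence: $(\rho_n)\subset[0,1)$ is a fixed (deterministic) sequence of radii, $(\theta_n(\omega))$ is a sequence of independent random variables, all uniformly distributed on $[0,2\pi]$, and $\Lambda=\Lambda(\omega)=\{\lambda_n\}$ is the set of points $\lambda_n=\rho_n e^{i\theta_n(\omega)}$. For $n=0,1,2,\ldots$, $N_n=\#\{\lambda\in\Lambda(\omega): 1-2^{-n}\le|\lambda|<1-2^{-n-1}\}$; almost surely this depends only on the radii. Sums over $n$ run over $n\ge0$. The weighted Dirichlet space $\mathcal{D}_\alpha$ is the space of analytic functions $f$ on $\mathbb{D}$ with $\|f\|_\alpha^2=|f(0)|^2+\int_{\mathbb{D}}|f'(z)|^2(1-|z|^2)^{1-\alpha}\,dA(z)<\infty$, where $dA=dx\,dy/\pi$. $\delta_\lambda$ denotes the unit point mass at $\lambda$. A positive Borel measure $\mu$ on $\mathbb{D}$ is a Carleson measure for $\mathcal{D}_\alpha$ if there is a constant $C$ such that $\int_{\mathbb{D}}|f|^2\,d\mu\le C\|f\|_\alpha^2$ for all $f\in\mathcal{D}_\alpha$. *)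

theory Defs
  imports "HOL-Probability.Probability" "HOL-Complex_Analysis.Complex_Analysis"
begin

text \<open>
  Norms, counts and integrals take values in \<^typ>\<open>ennreal\<close>, so that divergence is an honest
  \<open>\<infinity>\<close> rather than the junk value \<open>0\<close>.
\<close>

abbreviation unit_disc :: "complex set" where
  "unit_disc \<equiv> ball 0 1"

text \<open>
  On \<^typ>\<open>complex\<close>, \<^term>\<open>lborel\<close> is planar Lebesgue measure; the factor \<open>1 / \<pi>\<close> normalises
  it to \<open>dA = dx dy / \<pi>\<close>.
\<close>

definition dirichlet_norm_sq :: "real \<Rightarrow> (complex \<Rightarrow> complex) \<Rightarrow> ennreal" where
  "dirichlet_norm_sq \<alpha> f =
     ennreal ((cmod (f 0))\<^sup>2) +
     (\<integral>\<^sup>+z\<in>unit_disc.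
        ennreal ((cmod (deriv f z))\<^sup>2 * (1 - (cmod z)\<^sup>2) powr (1 - \<alpha>) * (1 / pi)) \<partial>lborel)"

definition dirichlet_space :: "real \<Rightarrow> (complex \<Rightarrow> complex) set" where
  "dirichlet_space \<alpha> = {f. f holomorphic_on unit_disc \<and> dirichlet_norm_sq \<alpha> f < \<infinity>}"

definition carleson_measure :: "real \<Rightarrow> complex measure \<Rightarrow> bool" where
  "carleson_measure \<alpha> \<mu> \<longleftrightarrow>
     sets \<mu> = sets (restrict_space borel unit_disc) \<and>
     (\<exists>C::real. \<forall>f\<in>dirichlet_space \<alpha>.
        (\<integral>\<^sup>+z. ennreal ((cmod (f z))\<^sup>2) \<partial>\<mu>) \<le> ennreal C * dirichlet_norm_sq \<alpha> f)"

text \<open>A set of points, not an indexed family: coinciding \<open>\<lambda>\<^sub>k\<close> are counted once.\<close>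

definition random_points :: "(nat \<Rightarrow> real) \<Rightarrow> (nat \<Rightarrow> 'w \<Rightarrow> real) \<Rightarrow> 'w \<Rightarrow> complex set" where
  "random_points \<rho> \<theta> \<omega> = range (\<lambda>k. rcis (\<rho> k) (\<theta> k \<omega>))"

definition annulus_count :: "complex set \<Rightarrow> nat \<Rightarrow> ennreal" where
  "annulus_count \<Lambda> n = emeasure (count_space UNIV)
     {z\<in>\<Lambda>. 1 - 2 powr (- real n) \<le> cmod z \<and> cmod z < 1 - 2 powr (- real n - 1)}"

text \<open>
  The sum of weighted point masses is the weighted counting measure on \<open>\<Lambda>\<close>, pushed forward
  along the inclusion of \<open>\<Lambda>\<close> into the disc to make it a Borel measure there.
\<close>

definition point_mass_measure :: "real \<Rightarrow> complex set \<Rightarrow> complex measure" where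
  "point_mass_measure \<alpha> \<Lambda> =
     distr (density (count_space \<Lambda>) (\<lambda>z. ennreal ((1 - (cmod z)\<^sup>2) powr (1 - \<alpha>))))
       (restrict_space borel unit_disc) (\<lambda>z. z)"

lemma emeasure_point_mass_measure:
  assumes "\<Lambda> \<subseteq> unit_disc" "A \<in> sets (restrict_space borel unit_disc)"
  shows "emeasure (point_mass_measure \<alpha> \<Lambda>) A =
    (\<integral>\<^sup>+l. ennreal ((1 - (cmod l)\<^sup>2) powr (1 - \<alpha>)) *
        emeasure (return (restrict_space borel unit_disc) l) A \<partial>count_space \<Lambda>)"
proof -
  let ?D = "density (count_space \<Lambda>) (\<lambda>z. ennreal ((1 - (cmod z)\<^sup>2) powr (1 - \<alpha>)))"
  have "(\<lambda>z. z) \<in> measurable ?D (restrict_space borel unit_disc)"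
    using assms(1) by (auto simp: measurable_def space_restrict_space)
  then have "emeasure (point_mass_measure \<alpha> \<Lambda>) A = emeasure ?D (A \<inter> \<Lambda>)"
    using assms(2) by (simp add: point_mass_measure_def emeasure_distr)
  also have "\<dots> = (\<integral>\<^sup>+l. ennreal ((1 - (cmod l)\<^sup>2) powr (1 - \<alpha>)) * indicator (A \<inter> \<Lambda>) l
      \<partial>count_space \<Lambda>)"
    by (subst emeasure_density) auto
  also have "\<dots> = (\<integral>\<^sup>+l. ennreal ((1 - (cmod l)\<^sup>2) powr (1 - \<alpha>)) *
        emeasure (return (restrict_space borel unit_disc) l) A \<partial>count_space \<Lambda>)"
    using assms(2) by (intro nn_integral_cong) (auto split: split_indicator)
  finally show ?thesis .
qed

end

theory Submission
  imports Defs
begin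

text \<open>
  Write \<open>\<beta> = 1 - \<alpha>\<close>. A point \<open>z\<close> with \<open>1 - \<bar>z\<bar>\<close> of size \<open>2 powr (- n)\<close> has level \<open>n\<close>; its mass is of size
  \<open>2 powr (- \<beta> n)\<close>, so the hypothesis says that the measure has finite total mass. Three ideas
  turn this into a Carleson estimate.

  Duality. Up to equivalence of norms, the Dirichlet space has the reproducing kernel \<open>(1 - cnj w * z) powr (- \<beta>)\<close>.
  What enters is that the Dirichlet norm dominates the weighted \<open>\<ell>\<^sup>2\<close> norm of the
  Taylor coefficients, with the inverse Taylor coefficients of the kernel as weights. Testing
  with \<open>c\<^sub>i = m\<^sub>i cnj (f z\<^sub>i)\<close>, where \<open>m\<^sub>i\<close> is the mass at \<open>z\<^sub>i\<close>, the Carleson inequality for finitely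
  many points follows from
  \<open>\<Sum> \<bar>c\<^sub>i\<bar> \<bar>c\<^sub>j\<bar> \<bar>1 - cnj z\<^sub>i * z\<^sub>j\<bar> powr (- \<beta>) \<le> C \<Sum> \<bar>c\<^sub>i\<bar>\<^sup>2 / m\<^sub>i\<close> (lemmas \<open>dirichlet_duality\<close> and
  \<open>finite_carleson_bound\<close>).

  Dyadic arcs. The kernel at \<open>(z\<^sub>i, z\<^sub>j)\<close> is at most of size \<open>2 powr (\<beta> k)\<close> for some \<open>k\<close> not above either
  level for which the two arguments lie in the same or in neighbouring dyadic arcs of generation
  \<open>k\<close>. The quadratic form is therefore dominated by squares of sums over Carleson boxes, weighted by
  \<open>2 powr (\<beta> k)\<close>. A weighted Cauchy-Schwarz inequality bounds these as soon as, for some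
  \<open>\<epsilon> \<le> min \<alpha> \<beta> / 3\<close>, every arc of generation \<open>k \<le> m\<close> contains at most
  \<open>K (2 powr (\<epsilon> (m - k)) + N\<^sub>m 2 powr (- (1 - \<epsilon>) k))\<close> of the \<open>N\<^sub>m\<close> points of level \<open>m\<close>
  (lemma \<open>dyadic_schur_bound\<close>). Total mass enters through the second summand.

  Randomness. The expected number of points of level \<open>m\<close> in an arc of generation \<open>k\<close> is \<open>N\<^sub>m 2 powr (- k)\<close>. The
  count bound leaves a factor \<open>2 powr (\<epsilon> k)\<close> above this mean, and also a first summand that is large
  when \<open>k\<close> is much smaller than \<open>m\<close>. By Chernoff, for large \<open>K\<close> a violation has probability at most
  \<open>8 powr (- m)\<close>. There are only about \<open>2\<^sup>m\<close> arcs with \<open>k \<le> m\<close>, so by Borel-Cantelli the bound holds almost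
  surely, for a random \<open>K\<close> (lemma \<open>AE_arc_counts_bounded\<close>).
\<close>

section \<open>Area integrals of radial weights\<close>

lemma nn_integral_lborel_translate:
  fixes f :: "'a::euclidean_space \<Rightarrow> ennreal"
  assumes [measurable]: "f \<in> borel_measurable borel"
  shows "(\<integral>\<^sup>+x. f (d + x) \<partial>lborel) = (\<integral>\<^sup>+x. f x \<partial>lborel)"
proof -
  have "(\<integral>\<^sup>+x. f x \<partial>lborel) = (\<integral>\<^sup>+x. f x \<partial>distr lborel borel ((+) d))"
    by (simp add: lborel_distr_plus)
  also have "\<dots> = (\<integral>\<^sup>+x. f (d + x) \<partial>lborel)"
    by (rule nn_integral_distr) auto
  finally show ?thesis by simp
qed

text \<open>
  Uniqueness of translation invariant measures, with the unit disc as the reference set: computing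
  the \<open>lborel\<close> measure of all pairs \<open>(x, y)\<close> with \<open>c * x \<in> S\<close> and \<open>y - c * x\<close> in the disc in both orders of
  integration gives \<open>\<nu> S * \<pi> = \<lambda> S * \<pi>\<close> for the rotated measure \<open>\<nu>\<close>, because rotation preserves the disc.
\<close>

lemma lborel_distr_rotation:
  fixes c :: complex
  assumes c: "cmod c = 1"
  shows "distr lborel borel ((*) c) = lborel"
proof (rule measure_eqI)
  fix S assume "S \<in> sets (distr lborel borel ((*) c))"
  then have S[measurable]: "S \<in> sets borel" by simp
  let ?B = "ball 0 1 :: complex set"
  have B[measurable]: "?B \<in> sets borel" by simp
  have c0: "c \<noteq> 0" using c by auto
  \<comment> \<open>Translate in \<open>y\<close> by \<open>c * x\<close>, swap, and translate in \<open>x\<close> by \<open>y / c\<close>.\<close>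
  have "emeasure (distr lborel borel ((*) c)) S * emeasure lborel ?B
      = (\<integral>\<^sup>+x. indicator S (c * x) \<partial>lborel) * emeasure lborel ?B"
    by (simp flip: nn_integral_indicator add: nn_integral_distr)
  also have "\<dots> = (\<integral>\<^sup>+x. indicator S (c * x) * (\<integral>\<^sup>+y. indicator ?B (- (c * x) + y) \<partial>lborel) \<partial>lborel)"
    by (subst nn_integral_lborel_translate) (simp_all add: nn_integral_multc)
  also have "\<dots> = (\<integral>\<^sup>+x. (\<integral>\<^sup>+y. indicator S (c * x) * indicator ?B (- (c * x) + y) \<partial>lborel) \<partial>lborel)"
    by (intro nn_integral_cong nn_integral_cmult[symmetric]) auto
  also have "\<dots> = (\<integral>\<^sup>+y. (\<integral>\<^sup>+x. indicator S (c * x) * indicator ?B (- (c * x) + y) \<partial>lborel) \<partial>lborel)"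
    by (rule lborel_pair.Fubini') measurable
  also have "\<dots> = (\<integral>\<^sup>+y. (\<integral>\<^sup>+x. indicator S (c * (y / c + x)) * indicator ?B (- (c * (y / c + x)) + y) \<partial>lborel) \<partial>lborel)"
    by (intro nn_integral_cong nn_integral_lborel_translate[symmetric]) measurable
  also have "\<dots> = (\<integral>\<^sup>+y. (\<integral>\<^sup>+x. indicator S (c * x + y) * indicator ?B x \<partial>lborel) \<partial>lborel)"
  proof (intro nn_integral_cong)
    fix y x
    have "c * (y / c + x) = c * x + y" using c0 by (simp add: distrib_left)
    then show "indicator S (c * (y / c + x)) * indicator ?B (- (c * (y / c + x)) + y)
        = (indicator S (c * x + y) * indicator ?B x :: ennreal)"
      using c by (simp add: indicator_def norm_mult)
  qed
  also have "\<dots> = (\<integral>\<^sup>+x. (\<integral>\<^sup>+y. indicator S (c * x + y) * indicator ?B x \<partial>lborel) \<partial>lborel)"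
    by (rule lborel_pair.Fubini') measurable
  also have "\<dots> = (\<integral>\<^sup>+x. emeasure lborel S * indicator ?B x \<partial>lborel)"
    by (intro nn_integral_cong) (simp add: nn_integral_multc nn_integral_lborel_translate)
  also have "\<dots> = emeasure lborel S * emeasure lborel ?B"
    by (simp add: nn_integral_cmult)
  finally have "emeasure (distr lborel borel ((*) c)) S * emeasure lborel ?B = \<dots>" .
  moreover have "emeasure lborel ?B = ennreal pi"
    by (simp add: emeasure_ball unit_ball_vol_2)
  ultimately show "emeasure (distr lborel borel ((*) c)) S = emeasure lborel S"
    by (metis divide_ennreal_def ennreal_mult_divide_eq ennreal_eq_0_iff ennreal_neq_top pi_gt_zero not_le)
qed simp

lemma borel_measurable_cnj [measurable]: "cnj \<in> borel_measurable borel"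
  by (intro borel_measurable_continuous_onI continuous_intros)

text \<open>
  The rotation by \<open>\<pi> / \<bar>m - n\<bar>\<close> changes the sign of the integrand. Where it is not
  integrable, the integral is the default value \<open>0\<close>.
\<close>

lemma integral_monomials_orthogonal:
  fixes w :: "real \<Rightarrow> real"
  assumes [measurable]: "w \<in> borel_measurable borel" and "m \<noteq> n"
  shows "(LINT z|lborel. z ^ m * cnj z ^ n * complex_of_real (w (cmod z))) = 0"
    (is "integral\<^sup>L lborel ?F = 0")
proof -
  define k where "k = (if m < n then n - m else m - n)"
  have k: "k > 0" using \<open>m \<noteq> n\<close> by (auto simp: k_def)
  define c where "c = cis (pi / real k)"
  have cn: "cmod c = 1" "cnj c = inverse c" by (auto simp: c_def cis_inverse cis_cnj)
  have cc: "c * cnj c = 1" unfolding c_def by (simp only: cis_cnj cis_mult) simp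
  have "c ^ k = cis (real k * (pi / real k))"
    unfolding c_def by (rule Complex.DeMoivre)
  then have "c ^ k = -1" using k by simp
  then have c': "c ^ m * cnj c ^ n = -1"
  proof (cases "m < n")
    case True
    then have n: "n = m + k" by (simp add: k_def)
    have "c ^ m * cnj c ^ n = (c * cnj c) ^ m * cnj (c ^ k)"
      by (simp add: n power_add power_mult_distrib)
    then show ?thesis using \<open>c ^ k = -1\<close> cc by simp
  next
    case False
    then have m: "m = n + k" using assms(2) by (simp add: k_def)
    have "c ^ m * cnj c ^ n = (c * cnj c) ^ n * (c ^ k)"
      by (simp add: m power_add power_mult_distrib)
    then show ?thesis using \<open>c ^ k = -1\<close> cc by simp
  qed
  have "integral\<^sup>L lborel ?F = integral\<^sup>L (distr lborel borel ((*) c)) ?F"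
    by (simp add: lborel_distr_rotation cn)
  also have "\<dots> = (LINT z|lborel. ?F (c * z))"
    by (rule integral_distr) measurable
  also have "(\<lambda>z. ?F (c * z)) = (\<lambda>z. - ?F z)"
  proof
    fix z
    have "?F (c * z) = (c ^ m * cnj c ^ n) * ?F z"
      by (simp add: power_mult_distrib norm_mult cn)
    then show "?F (c * z) = - ?F z" by (simp only: c') simp
  qed
  finally show ?thesis by simp
qed

text \<open>
  The substitute for polar coordinates: \<open>\<bar>z\<bar>\<^sup>2\<close> is uniformly distributed on the disc, since the area
  \<open>\<pi> r\<^sup>2\<close> of a disc is linear in \<open>r\<^sup>2\<close>.
\<close>

lemma distr_cmod_square_disc:
  "distr (restrict_space lborel unit_disc) borel (\<lambda>z. (cmod z)\<^sup>2)
     = density lborel (\<lambda>t. ennreal pi * indicator {0<..<1} t)"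
  (is "?L = ?R")
proof (rule measure_eqI_lessThan)
  fix x :: real
  have S: "(\<lambda>z. (cmod z)\<^sup>2) \<in> restrict_space lborel unit_disc \<rightarrow>\<^sub>M borel"
    by (intro measurable_restrict_space1) measurable
  have L: "emeasure ?L {x<..} = emeasure lborel {z \<in> unit_disc. x < (cmod z)\<^sup>2}"
    using S by (subst emeasure_distr)
      (auto simp: emeasure_restrict_space space_restrict_space intro!: arg_cong[where f="emeasure lborel"])
  have ball: "emeasure lborel (ball 0 r :: complex set) = ennreal (pi * r\<^sup>2)" if "r \<ge> 0" for r
    using that by (simp add: emeasure_ball unit_ball_vol_2)
  have cball: "emeasure lborel (cball 0 r :: complex set) = ennreal (pi * r\<^sup>2)" if "r \<ge> 0" for r
    using that by (simp add: emeasure_cball unit_ball_vol_2)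
  have R: "emeasure ?R {x<..} = ennreal (pi * (1 - max 0 (min x 1)))"
  proof -
    have "emeasure ?R {x<..} = (\<integral>\<^sup>+t. ennreal pi * indicator {max x 0<..<1} t \<partial>lborel)"
      by (subst emeasure_density) (auto intro!: nn_integral_cong simp: indicator_def)
    also have "\<dots> = ennreal pi * emeasure lborel {max x 0<..<1}"
      by (simp add: nn_integral_cmult)
    also have "emeasure lborel {max x 0<..<1} = ennreal (1 - max 0 (min x 1))"
      by (cases "max x 0 \<le> 1") (auto simp: max_def min_def split: if_splits)
    finally show ?thesis by (simp add: ennreal_mult max_def min_def)
  qed
  have L2: "emeasure lborel {z \<in> unit_disc. x < (cmod z)\<^sup>2} = ennreal (pi * (1 - max 0 (min x 1)))"
  proof -
    consider "x < 0" | "0 \<le> x" "x < 1" | "1 \<le> x" by linarith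
    then show ?thesis
    proof cases
      case 1
      then have "{z \<in> unit_disc. x < (cmod z)\<^sup>2} = unit_disc"
        by (auto intro: less_le_trans)
      then show ?thesis using 1 ball[of 1] by simp
    next
      case 2
      have sq: "x < (cmod z)\<^sup>2 \<longleftrightarrow> sqrt x < cmod z" for z
        by (metis real_sqrt_less_iff real_sqrt_abs abs_norm_cancel)
      have "{z \<in> unit_disc. x < (cmod z)\<^sup>2} = unit_disc - cball 0 (sqrt x)"
        by (auto simp only: sq not_le mem_Collect_eq Diff_iff mem_cball_0)
      moreover have "emeasure lborel (unit_disc - cball 0 (sqrt x))
         = emeasure lborel unit_disc - emeasure lborel (cball 0 (sqrt x) :: complex set)"
      proof -
        have "sqrt x < 1" using 2 by simp
        then have "cball 0 (sqrt x) \<subseteq> (unit_disc :: complex set)"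
          by (simp only: cball_subset_ball_iff) simp
        then show ?thesis
          using 2 by (intro emeasure_Diff) (auto simp: cball)
      qed
      ultimately show ?thesis
        using 2 ball[of 1] cball[of "sqrt x"] 
        by (simp add: ennreal_minus right_diff_distrib)
    next
      case 3
      have "\<not> x < (cmod z)\<^sup>2" if "cmod z < 1" for z
      proof -
        have "(cmod z)\<^sup>2 \<le> 1\<^sup>2" using that by (intro power_mono) auto
        then show ?thesis using 3 by simp
      qed
      then have "{z \<in> unit_disc. x < (cmod z)\<^sup>2} = {}" by auto
      then show ?thesis using 3 by (simp only:) simp
    qed
  qed
  show "emeasure ?L {x<..} = emeasure ?R {x<..}" by (simp only: L R L2)
  show "emeasure ?L {x<..} < \<infinity>" by (simp only: L L2) simp
qed auto

lemma nn_integral_disc_moment: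
  assumes "\<beta> > -1"
  shows "(\<integral>\<^sup>+z\<in>unit_disc. ennreal ((cmod z) ^ (2 * n) * (1 - (cmod z)\<^sup>2) powr \<beta>) \<partial>lborel)
    = ennreal (pi * Beta (real n + 1) (\<beta> + 1))"
proof -
  have S: "(\<lambda>z. (cmod z)\<^sup>2) \<in> restrict_space lborel unit_disc \<rightarrow>\<^sub>M borel"
    by (intro measurable_restrict_space1) measurable
  let ?h = "\<lambda>t. ennreal (t ^ n * (1 - t) powr \<beta>)"
  have "(\<integral>\<^sup>+z\<in>unit_disc. ennreal ((cmod z) ^ (2 * n) * (1 - (cmod z)\<^sup>2) powr \<beta>) \<partial>lborel)
      = (\<integral>\<^sup>+z. ?h ((cmod z)\<^sup>2) \<partial>restrict_space lborel unit_disc)"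
    by (subst nn_integral_restrict_space) (auto simp: power_mult)
  also have "\<dots> = (\<integral>\<^sup>+t. ?h t \<partial>distr (restrict_space lborel unit_disc) borel (\<lambda>z. (cmod z)\<^sup>2))"
    by (rule nn_integral_distr[OF S, symmetric]) measurable
  also have "\<dots> = (\<integral>\<^sup>+t. ennreal pi * indicator {0<..<1} t * ?h t \<partial>lborel)"
    by (subst distr_cmod_square_disc, subst nn_integral_density) auto
  also have "\<dots> = (\<integral>\<^sup>+t. ennreal pi * ennreal (t powr (real n + 1 - 1) * (1 - t) powr (\<beta> + 1 - 1) * indicator {0<..<1} t) \<partial>lborel)"
    by (intro nn_integral_cong) (auto simp: indicator_def powr_realpow)
  also have "\<dots> = ennreal pi * (\<integral>\<^sup>+t. ennreal (t powr (real n + 1 - 1) * (1 - t) powr (\<beta> + 1 - 1) * indicator {0<..<1} t) \<partial>lborel)"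
    by (subst nn_integral_cmult) auto
  also have "(\<integral>\<^sup>+t. ennreal (t powr (real n + 1 - 1) * (1 - t) powr (\<beta> + 1 - 1) * indicator {0<..<1} t) \<partial>lborel)
     = ennreal (Beta (real n + 1) (\<beta> + 1))"
    using assms has_integral_Beta_real[of "real n + 1" "\<beta> + 1"]
    by (subst mult.commute[of _ "indicator _ _"], intro nn_integral_has_integral_lebesgue)
      (auto simp: has_integral_Icc_iff_Ioo)
  finally show ?thesis by (simp add: ennreal_mult')
qed

lemma sum_norm_square_double:
  fixes b :: "nat \<Rightarrow> complex"
  shows "complex_of_real ((cmod (\<Sum>n<N. b n * z ^ n))\<^sup>2 * v)
    = (\<Sum>m<N. \<Sum>n<N. (b m * cnj (b n)) * (z ^ m * cnj z ^ n * complex_of_real v))"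
proof -
  have "complex_of_real ((cmod (\<Sum>n<N. b n * z ^ n))\<^sup>2)
     = (\<Sum>m<N. b m * z ^ m) * (\<Sum>n<N. cnj (b n) * cnj z ^ n)"
    by (subst complex_norm_square) simp
  also have "\<dots> = (\<Sum>m<N. \<Sum>n<N. (b m * z ^ m) * (cnj (b n) * cnj z ^ n))"
    by (rule sum_product)
  finally have "complex_of_real ((cmod (\<Sum>n<N. b n * z ^ n))\<^sup>2 * v)
     = (\<Sum>m<N. \<Sum>n<N. (b m * z ^ m) * (cnj (b n) * cnj z ^ n)) * complex_of_real v"
    by (simp only: of_real_mult)
  then show ?thesis
    by (simp only: sum_distrib_right) (simp only: mult_ac)
qed

lemma integrable_disc_bounded:
  fixes F :: "complex \<Rightarrow> 'a::{banach,second_countable_topology}"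
  assumes [measurable]: "F \<in> borel_measurable borel" and "\<And>z. cmod z < 1 \<Longrightarrow> norm (F z) \<le> B"
    and "\<And>z. cmod z \<ge> 1 \<Longrightarrow> F z = 0"
  shows "integrable lborel F"
proof (rule integrableI_bounded_set[where A="unit_disc" and B=B])
  show "emeasure lborel (unit_disc :: complex set) < \<infinity>"
    by (simp add: emeasure_ball)
  show "AE z in lborel. z \<in> unit_disc \<longrightarrow> norm (F z) \<le> B" using assms by auto
  show "AE z in lborel. z \<notin> unit_disc \<longrightarrow> F z = 0" using assms by auto
qed auto

text \<open>
  Parseval's identity for a radial weight; the off-diagonal terms vanish by
  \<open>integral_monomials_orthogonal\<close>.
\<close>

lemma integral_polynomial_square:
  fixes v :: "real \<Rightarrow> real" and b :: "nat \<Rightarrow> complex"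
  assumes v[measurable]: "v \<in> borel_measurable borel"
    and vb: "\<And>r. 0 \<le> v r" "\<And>r. v r \<le> 1" "\<And>r. r \<ge> 1 \<Longrightarrow> v r = 0"
  shows "(LINT z|lborel. (cmod (\<Sum>n<N. b n * z ^ n))\<^sup>2 * v (cmod z))
    = (\<Sum>n<N. (cmod (b n))\<^sup>2 * (LINT z|lborel. cmod z ^ (2 * n) * v (cmod z)))"
proof -
  have int: "integrable lborel (\<lambda>z. z ^ m * cnj z ^ n * complex_of_real (v (cmod z)))" for m n
  proof (rule integrable_disc_bounded[where B=1])
    fix z :: complex assume "cmod z < 1"
    then have "cmod z ^ m * cmod z ^ n * v (cmod z) \<le> 1 * 1 * 1"
      using vb by (intro mult_mono power_le_one) auto
    then show "norm (z ^ m * cnj z ^ n * complex_of_real (v (cmod z))) \<le> 1"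
      using vb by (simp add: norm_mult norm_power)
  qed (use vb in \<open>measurable, auto\<close>)
  have diag: "(LINT z|lborel. z ^ n * cnj z ^ n * complex_of_real (v (cmod z)))
     = complex_of_real (LINT z|lborel. cmod z ^ (2 * n) * v (cmod z))" for n
  proof -
    have "z ^ n * cnj z ^ n = complex_of_real (cmod z ^ (2 * n))" for z
      using complex_norm_square[of z] by (simp add: power_mult flip: power_mult_distrib)
    then have "(LINT z|lborel. z ^ n * cnj z ^ n * complex_of_real (v (cmod z)))
       = (LINT z|lborel. complex_of_real (cmod z ^ (2 * n) * v (cmod z)))"
      by (simp only: of_real_mult)
    then show ?thesis by (simp only: integral_complex_of_real)
  qed
  have "complex_of_real (LINT z|lborel. (cmod (\<Sum>n<N. b n * z ^ n))\<^sup>2 * v (cmod z))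
     = (LINT z|lborel. (\<Sum>m<N. \<Sum>n<N. (b m * cnj (b n)) * (z ^ m * cnj z ^ n * complex_of_real (v (cmod z)))))"
    by (simp only: integral_complex_of_real[symmetric] sum_norm_square_double)
  also have "\<dots> = (\<Sum>m<N. \<Sum>n<N. (b m * cnj (b n)) * (LINT z|lborel. z ^ m * cnj z ^ n * complex_of_real (v (cmod z))))"
    using int by (simp add: Bochner_Integration.integral_sum)
  also have "\<dots> = (\<Sum>m<N. \<Sum>n<N. if n = m then (b m * cnj (b m)) *
       complex_of_real (LINT z|lborel. cmod z ^ (2 * m) * v (cmod z)) else 0)"
    by (intro sum.cong refl) (simp add: diag integral_monomials_orthogonal[OF v])
  also have "\<dots> = complex_of_real (\<Sum>n<N. (cmod (b n))\<^sup>2 * (LINT z|lborel. cmod z ^ (2 * n) * v (cmod z)))"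
    unfolding of_real_sum of_real_mult complex_norm_square by (intro sum.cong refl) simp
  finally show ?thesis by (simp only: of_real_eq_iff)
qed

text \<open>
  On a disc of radius \<open>R < 1\<close> the partial sums of the power series are uniformly bounded, so Parseval's
  identity for polynomials passes to the limit by dominated convergence.
\<close>

lemma bessel_radial_weight_compact:
  fixes v :: "real \<Rightarrow> real" and b :: "nat \<Rightarrow> complex"
  assumes g: "\<And>z. cmod z < 1 \<Longrightarrow> (\<lambda>n. b n * z ^ n) sums g z"
    and v[measurable]: "v \<in> borel_measurable borel"
    and vb: "\<And>r. 0 \<le> v r" "\<And>r. v r \<le> 1" "\<And>r. r \<ge> R \<Longrightarrow> v r = 0" and R: "0 < R" "R < 1"
  shows "(\<Sum>n<N. (cmod (b n))\<^sup>2 * (LINT z|lborel. cmod z ^ (2 * n) * v (cmod z)))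
     \<le> (LINT z|lborel. (cmod (g z))\<^sup>2 * v (cmod z))"
    and "integrable lborel (\<lambda>z. (cmod (g z))\<^sup>2 * v (cmod z))"
proof -
  have v1: "v r = 0" if "r \<ge> 1" for r using vb(3) R that by auto
  have "summable (\<lambda>n. b n * of_real ((R + 1) / 2) ^ n)"
    using g[of "of_real ((R + 1) / 2)"] R by (simp only: norm_of_real) (auto simp: sums_iff)
  then have sm: "summable (\<lambda>n. cmod (b n * of_real R ^ n))"
    by (rule powser_insidea) (use R in \<open>simp only: norm_of_real, auto\<close>)
  define S where "S = (\<Sum>n. cmod (b n) * R ^ n)"
  have sm': "summable (\<lambda>n. cmod (b n) * R ^ n)"
    using sm R by (simp add: norm_mult norm_power)
  let ?p = "\<lambda>N z. \<Sum>n<N. b n * z ^ n"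
  have pb: "cmod (?p N z) \<le> S" if "cmod z < R" for N z
  proof -
    have "cmod (?p N z) \<le> (\<Sum>n<N. cmod (b n) * cmod z ^ n)"
      by (rule order_trans[OF norm_sum]) (simp add: norm_mult norm_power)
    also have "\<dots> \<le> (\<Sum>n<N. cmod (b n) * R ^ n)"
      using that by (intro sum_mono mult_left_mono power_mono) auto
    also have "\<dots> \<le> S" unfolding S_def using sm' R by (intro sum_le_suminf) auto
    finally show ?thesis .
  qed
  define G where "G = (\<lambda>N z. (cmod (?p N z))\<^sup>2 * v (cmod z))"
  have Gm[measurable]: "G N \<in> borel_measurable borel" for N
    unfolding G_def by measurable
  have lim: "(\<lambda>N. G N z) \<longlonglongrightarrow> (cmod (g z))\<^sup>2 * v (cmod z)" for z
  proof (cases "cmod z < 1")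
    case True
    then have "(\<lambda>N. ?p N z) \<longlonglongrightarrow> g z" using g by (simp add: sums_def)
    then show ?thesis unfolding G_def by (intro tendsto_intros)
  next
    case False
    then show ?thesis by (simp add: G_def v1)
  qed
  have gm[measurable]: "(\<lambda>z. (cmod (g z))\<^sup>2 * v (cmod z)) \<in> borel_measurable borel"
    by (rule borel_measurable_LIMSEQ_real[OF lim Gm])
  have dom: "integrable lborel (\<lambda>z :: complex. S\<^sup>2 * indicator unit_disc z :: real)"
    by (intro integrable_mult_right integrable_real_indicator) (auto simp: emeasure_ball)
  have bound: "norm (G N z) \<le> S\<^sup>2 * indicator unit_disc z" for N z
  proof (cases "cmod z < R")
    case True
    have "(cmod (?p N z))\<^sup>2 * v (cmod z) \<le> S\<^sup>2 * 1"
      using pb[OF True] vb by (intro mult_mono power_mono) auto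
    then show ?thesis using True R vb by (simp add: G_def)
  next
    case False
    then show ?thesis by (simp add: G_def vb)
  qed
  have conv: "(\<lambda>N. integral\<^sup>L lborel (G N)) \<longlonglongrightarrow> (LINT z|lborel. (cmod (g z))\<^sup>2 * v (cmod z))"
    by (rule integral_dominated_convergence[OF _ _ dom]; use lim bound in simp)
  have "integrable lborel (\<lambda>z. (cmod (g z))\<^sup>2 * v (cmod z))"
    by (rule integrable_dominated_convergence[OF _ _ dom]; (rule AE_I2)?; (rule lim bound)?) simp_all
  then show "integrable lborel (\<lambda>z. (cmod (g z))\<^sup>2 * v (cmod z))" by simp
  show "(\<Sum>n<N. (cmod (b n))\<^sup>2 * (LINT z|lborel. cmod z ^ (2 * n) * v (cmod z)))
     \<le> (LINT z|lborel. (cmod (g z))\<^sup>2 * v (cmod z))"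
  proof (rule LIMSEQ_le_const[OF conv], intro exI allI impI)
    fix K assume "N \<le> K"
    have "integral\<^sup>L lborel (G K) = (\<Sum>n<K. (cmod (b n))\<^sup>2 * (LINT z|lborel. cmod z ^ (2 * n) * v (cmod z)))"
      unfolding G_def using vb v1 by (intro integral_polynomial_square) auto
    also have "\<dots> \<ge> (\<Sum>n<N. (cmod (b n))\<^sup>2 * (LINT z|lborel. cmod z ^ (2 * n) * v (cmod z)))"
      using \<open>N \<le> K\<close> vb by (intro sum_mono2) (auto intro!: mult_nonneg_nonneg integral_nonneg_AE)
    finally show "(\<Sum>n<N. (cmod (b n))\<^sup>2 * (LINT z|lborel. cmod z ^ (2 * n) * v (cmod z)))
      \<le> integral\<^sup>L lborel (G K)" .
  qed
qed

section \<open>Taylor coefficients and the reproducing kernel\<close>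

text \<open>
  The weight \<open>(1 - \<bar>z\<bar>\<^sup>2) powr \<beta>\<close> is not supported in a smaller disc, so it is cut off at the radii
  \<open>R j\<close>, which increase to \<open>1\<close>. Only the moments of the cut-off weights have to converge, because
  the integrals over smaller discs are at most the full one.
\<close>

lemma bergman_coefficient_bound:
  fixes b :: "nat \<Rightarrow> complex"
  assumes g: "\<And>z. cmod z < 1 \<Longrightarrow> (\<lambda>n. b n * z ^ n) sums g z" and \<beta>: "0 \<le> \<beta>"
    and x: "0 \<le> x" "(\<integral>\<^sup>+z\<in>unit_disc. ennreal ((cmod (g z))\<^sup>2 * (1 - (cmod z)\<^sup>2) powr \<beta>) \<partial>lborel) \<le> ennreal x"
  shows "(\<Sum>n<N. (cmod (b n))\<^sup>2 * (pi * Beta (real n + 1) (\<beta> + 1))) \<le> x"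
proof -
  define R where "R j = 1 - 1 / (real j + 2)" for j :: nat
  have R: "0 < R j" "R j < 1" for j by (auto simp: R_def field_simps)
  define w where "w r = indicator {-1<..<1} r * (1 - r\<^sup>2) powr \<beta>" for r :: real
  define v where "v j r = indicator {- R j<..<R j} r * (1 - r\<^sup>2) powr \<beta>" for j and r :: real
  have [measurable]: "w \<in> borel_measurable borel" "v j \<in> borel_measurable borel" for j
    unfolding w_def v_def by measurable
  have w: "0 \<le> w r" "w r \<le> 1" for r
  proof -
    have "(1 - r\<^sup>2) powr \<beta> \<le> 1" if "\<bar>r\<bar> < 1"
    proof -
      have "r\<^sup>2 < 1" using that by (simp add: abs_square_less_1)
      then show ?thesis using \<beta> by (intro powr_le1) auto
    qed
    then show "0 \<le> w r" "w r \<le> 1" by (auto simp: w_def indicator_def)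
  qed
  have vw: "0 \<le> v j r" "v j r \<le> w r" for j r
    using R[of j] by (auto simp: v_def w_def indicator_def)
  have v1: "v j r \<le> 1" for j r using vw w order_trans by blast
  have v0: "v j r = 0" if "r \<ge> R j" for j r using that by (simp add: v_def)
  have lim_v: "(\<lambda>j. v j r) \<longlonglongrightarrow> w r" if "0 \<le> r" for r
  proof (cases "r < 1")
    case True
    have "R \<longlonglongrightarrow> 1" unfolding R_def by real_asymp
    then have "eventually (\<lambda>j. r < R j) sequentially" using True by (rule order_tendstoD)
    then have "eventually (\<lambda>j. v j r = w r) sequentially"
      by eventually_elim (use that True in \<open>auto simp: v_def w_def indicator_def\<close>)
    then show ?thesis by (rule tendsto_eventually)
  next
    case False
    have "v j r = w r" for j
      using False R[of j] by (auto simp: v_def w_def indicator_def)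
    then show ?thesis by simp
  qed
  have dom: "integrable lborel (\<lambda>z. indicator unit_disc z :: real)"
    by (intro integrable_real_indicator) (auto simp: emeasure_ball)
  have lim: "(\<lambda>j. LINT z|lborel. cmod z ^ (2 * n) * v j (cmod z)) \<longlonglongrightarrow> (LINT z|lborel. cmod z ^ (2 * n) * w (cmod z))" for n
  proof (rule integral_dominated_convergence[OF _ _ dom])
    show "AE z in lborel. (\<lambda>j. cmod z ^ (2 * n) * v j (cmod z)) \<longlonglongrightarrow> cmod z ^ (2 * n) * w (cmod z)"
      by (intro AE_I2 tendsto_mult_left lim_v) auto
    fix j
    have "cmod z ^ (2 * n) * v j (cmod z) \<le> indicator unit_disc z" for z
    proof (cases "cmod z < 1")
      case True
      then have "cmod z ^ (2 * n) * v j (cmod z) \<le> 1 * 1"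
        using vw v1 by (intro mult_mono power_le_one) auto
      then show ?thesis using True by simp
    next
      case False
      then show ?thesis using v0[of j "cmod z"] R[of j] by simp
    qed
    then show "AE z in lborel. norm (cmod z ^ (2 * n) * v j (cmod z)) \<le> indicator unit_disc z"
      using vw by (intro AE_I2) simp
  qed measurable
  have moment: "(LINT z|lborel. cmod z ^ (2 * n) * w (cmod z)) = pi * Beta (real n + 1) (\<beta> + 1)" for n
  proof -
    have "0 \<le> Beta (real n + 1) (\<beta> + 1)"
      using \<beta> by (auto simp: Beta_def intro!: divide_nonneg_pos mult_nonneg_nonneg Gamma_real_nonneg Gamma_real_pos)
    moreover have "(\<integral>\<^sup>+z. ennreal (cmod z ^ (2 * n) * w (cmod z)) \<partial>lborel) = ennreal (pi * Beta (real n + 1) (\<beta> + 1))"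
    proof (rule trans[OF nn_integral_cong nn_integral_disc_moment])
      fix z :: complex
      have "-1 < cmod z" using norm_ge_zero[of z] by linarith
      then show "ennreal (cmod z ^ (2 * n) * w (cmod z))
          = ennreal (cmod z ^ (2 * n) * (1 - (cmod z)\<^sup>2) powr \<beta>) * indicator unit_disc z"
        by (cases "cmod z < 1") (auto simp: w_def)
    qed (use \<beta> in simp)
    ultimately show ?thesis
      using w by (subst integral_eq_nn_integral) auto
  qed
  have le: "(\<Sum>n<N. (cmod (b n))\<^sup>2 * (LINT z|lborel. cmod z ^ (2 * n) * v j (cmod z))) \<le> x" for j
  proof -
    have "(\<Sum>n<N. (cmod (b n))\<^sup>2 * (LINT z|lborel. cmod z ^ (2 * n) * v j (cmod z)))
       \<le> (LINT z|lborel. (cmod (g z))\<^sup>2 * v j (cmod z))"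
      using g by (intro bessel_radial_weight_compact(1)[OF _ _ vw(1) v1 v0 R]) auto
    also have "\<dots> \<le> x"
    proof -
      have "integrable lborel (\<lambda>z. (cmod (g z))\<^sup>2 * v j (cmod z))"
        using g by (intro bessel_radial_weight_compact(2)[OF _ _ vw(1) v1 v0 R]) auto
      then have "ennreal (LINT z|lborel. (cmod (g z))\<^sup>2 * v j (cmod z)) = (\<integral>\<^sup>+z. ennreal ((cmod (g z))\<^sup>2 * v j (cmod z)) \<partial>lborel)"
        using vw by (intro nn_integral_eq_integral[symmetric]) auto
      also have "\<dots> \<le> (\<integral>\<^sup>+z\<in>unit_disc. ennreal ((cmod (g z))\<^sup>2 * (1 - (cmod z)\<^sup>2) powr \<beta>) \<partial>lborel)"
        using R[of j] by (intro nn_integral_mono) (auto simp: v_def indicator_def)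
      finally show ?thesis using x order_trans ennreal_le_iff by blast
    qed
    finally show ?thesis .
  qed
  have "(\<lambda>j. \<Sum>n<N. (cmod (b n))\<^sup>2 * (LINT z|lborel. cmod z ^ (2 * n) * v j (cmod z)))
    \<longlonglongrightarrow> (\<Sum>n<N. (cmod (b n))\<^sup>2 * (LINT z|lborel. cmod z ^ (2 * n) * w (cmod z)))"
    by (intro tendsto_intros lim)
  then have "(\<Sum>n<N. (cmod (b n))\<^sup>2 * (LINT z|lborel. cmod z ^ (2 * n) * w (cmod z))) \<le> x"
    using le by (intro LIMSEQ_le_const2) auto
  then show ?thesis by (simp only: moment)
qed

text \<open>
  The Taylor coefficients of \<open>(1 - z) powr (- \<beta>)\<close>.
\<close>

definition kernel_coeff :: "real \<Rightarrow> nat \<Rightarrow> real" where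
  "kernel_coeff \<beta> n = pochhammer \<beta> n / fact n"

lemma kernel_coeff_pos: "0 < \<beta> \<Longrightarrow> 0 < kernel_coeff \<beta> n"
  by (simp add: kernel_coeff_def pochhammer_pos)

lemma kernel_power_series:
  assumes "cmod z < 1"
  shows "(\<lambda>n. of_real (kernel_coeff \<beta> n) * z ^ n) sums (1 - z) powr (- of_real \<beta>)"
proof -
  have "(\<lambda>n. ((- of_real \<beta>) gchoose n) * (- z) ^ n) sums (1 + - z) powr (- of_real \<beta>)"
    using assms by (intro gen_binomial_complex) simp
  moreover have "((- of_real \<beta>) gchoose n) * (- z) ^ n = of_real (kernel_coeff \<beta> n) * z ^ n" for n
  proof -
    have "(- z) ^ n = (-1) ^ n * z ^ n" by (rule power_minus)
    moreover have "((-1) ^ n * (-1) ^ n :: complex) = 1" by (simp flip: power_mult_distrib)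
    ultimately show ?thesis
      by (simp add: gbinomial_pochhammer kernel_coeff_def pochhammer_of_real)
  qed
  ultimately show ?thesis by simp
qed

text \<open>
  Both sides are quotients of Gamma values, and \<open>(n + 1)\<^sup>2 * Beta (n + 1) (\<beta> + 1) * kernel_coeff \<beta> (n + 1)\<close>
  collapses to \<open>(n + 1) * \<beta> / (n + 1 + \<beta>)\<close>, which is at least \<open>\<beta> / (1 + \<beta>)\<close>.
\<close>

lemma inverse_kernel_coeff_le_moment:
  assumes "0 < \<beta>"
  shows "1 / kernel_coeff \<beta> (Suc n) \<le> (1 + \<beta>) / \<beta> * ((real n + 1)\<^sup>2 * Beta (real n + 1) (\<beta> + 1))"
proof -
  define g G where "g = Gamma \<beta>" and "G = Gamma (\<beta> + real n + 1)"
  have pos: "g > 0" "G > 0" using assms by (auto simp: g_def G_def intro!: Gamma_real_pos)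
  have nonint: "x \<notin> \<int>\<^sub>\<le>\<^sub>0" if "x > 0" for x :: real using that nonpos_Ints_nonpos by force
  have G1: "Gamma (\<beta> + 1) = \<beta> * g" unfolding g_def using assms by (intro Gamma_plus1 nonint)
  have "Gamma ((\<beta> + real n + 1) + 1) = (\<beta> + real n + 1) * G"
    unfolding G_def using assms by (intro Gamma_plus1 nonint) auto
  then have G2: "Gamma (real n + 1 + (\<beta> + 1)) = (\<beta> + real n + 1) * G"
    by (simp add: add_ac)
  have F: "Gamma (real n + 1) = fact n" using Gamma_fact[of n, where 'a=real] by (simp add: add.commute)
  have P: "pochhammer \<beta> (Suc n) = G / g"
    unfolding G_def g_def using assms nonint by (subst pochhammer_Gamma) (auto simp: add_ac)
  have "(real n + 1)\<^sup>2 * Beta (real n + 1) (\<beta> + 1) * kernel_coeff \<beta> (Suc n)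
     = (real n + 1) * \<beta> / (\<beta> + real n + 1)"
  proof -
    have "\<beta> + real n + 1 > 0" "real n + 1 > 0" using assms by auto
    moreover have "fact (Suc n) = (real n + 1) * fact n" by (simp add: add.commute)
    ultimately show ?thesis
      unfolding Beta_def kernel_coeff_def F G1 G2 P using pos assms
      by (simp only: ) (simp add: divide_simps power2_eq_square)
  qed
  moreover have "\<beta> / (1 + \<beta>) \<le> (real n + 1) * \<beta> / (\<beta> + real n + 1)"
    using assms by (simp add: field_simps)
  ultimately have "\<beta> / (1 + \<beta>) \<le> (real n + 1)\<^sup>2 * Beta (real n + 1) (\<beta> + 1) * kernel_coeff \<beta> (Suc n)"
    by simp
  then show ?thesis using assms kernel_coeff_pos[OF assms, of "Suc n"]
    by (simp add: field_simps)
qed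

text \<open>
  The derivative of \<open>f\<close> has Taylor coefficients \<open>(n + 1) a\<^sub>n\<^sub>+\<^sub>1\<close>, so \<open>bergman_coefficient_bound\<close> bounds
  the sum of \<open>(n + 1)\<^sup>2 \<bar>a\<^sub>n\<^sub>+\<^sub>1\<bar>\<^sup>2\<close> times moments, and the moments are comparable to inverse kernel
  coefficients.
\<close>

lemma dirichlet_coefficient_bound:
  assumes f: "f \<in> dirichlet_space \<alpha>" and \<alpha>: "\<alpha> < 1"
  shows "(\<Sum>n<N. (cmod ((deriv ^^ n) f 0 / fact n))\<^sup>2 / kernel_coeff (1 - \<alpha>) n)
    \<le> (2 - \<alpha>) / (1 - \<alpha>) * enn2real (dirichlet_norm_sq \<alpha> f)"
proof -
  define \<beta> where "\<beta> = 1 - \<alpha>"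
  have \<beta>: "\<beta> > 0" using \<alpha> by (simp add: \<beta>_def)
  have hol: "f holomorphic_on unit_disc" and fin: "dirichlet_norm_sq \<alpha> f < \<infinity>"
    using f by (auto simp: dirichlet_space_def)
  define a where "a n = (deriv ^^ n) f 0 / fact n" for n
  define X where "X = (\<integral>\<^sup>+z\<in>unit_disc. ennreal ((cmod (deriv f z))\<^sup>2 * (1 - (cmod z)\<^sup>2) powr \<beta>) \<partial>lborel)"
  have hol': "deriv f holomorphic_on unit_disc" using hol by (intro holomorphic_deriv) auto
  have series: "(\<lambda>n. ((real n + 1) * a (Suc n)) * z ^ n) sums deriv f z" if "cmod z < 1" for z
  proof -
    have "(deriv ^^ n) (deriv f) 0 / fact n = (real n + 1) * a (Suc n)" for n
    proof -
      have "complex_of_real (real n + 1) = of_nat (Suc n)" by simp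
      then show ?thesis
        by (simp only: a_def fact_Suc funpow_Suc_right o_apply) (simp del: of_nat_Suc)
    qed
    then show ?thesis
      using holomorphic_power_series[OF hol', of z] that by simp
  qed
  define G where "G z = (cmod (indicator unit_disc z *\<^sub>R deriv f z))\<^sup>2 * (1 - (cmod z)\<^sup>2) powr \<beta>" for z
  have "(\<lambda>z. indicator unit_disc z *\<^sub>R deriv f z) \<in> borel_measurable borel"
    using holomorphic_on_imp_continuous_on[OF hol'] by (intro borel_measurable_continuous_on_indicator) auto
  then have [measurable]: "G \<in> borel_measurable borel" unfolding G_def by measurable
  have G0: "G z \<ge> 0" for z by (simp add: G_def)
  have X: "X = (\<integral>\<^sup>+z. ennreal (G z) \<partial>lborel)"
    unfolding X_def G_def by (intro nn_integral_cong) (auto simp: indicator_def)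
  have "(\<integral>\<^sup>+z\<in>unit_disc. ennreal ((cmod (deriv f z))\<^sup>2 * (1 - (cmod z)\<^sup>2) powr (1 - \<alpha>) * (1 / pi)) \<partial>lborel)
      = (\<integral>\<^sup>+z. ennreal (G z) * ennreal (1 / pi) \<partial>lborel)"
    using G0 by (intro nn_integral_cong) (auto simp: indicator_def G_def \<beta>_def simp flip: ennreal_mult)
  also have "\<dots> = X * ennreal (1 / pi)" by (simp add: X nn_integral_multc)
  finally have norm: "dirichlet_norm_sq \<alpha> f = ennreal ((cmod (f 0))\<^sup>2) + X * ennreal (1 / pi)"
    by (simp add: dirichlet_norm_sq_def)
  have "X * ennreal (1 / pi) < \<infinity>" using fin norm by (auto simp: less_top)
  then have "X < \<infinity>" by (auto simp: ennreal_mult_less_top less_top)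
  then obtain x where x: "X = ennreal x" "0 \<le> x" by (cases X) auto
  have d: "enn2real (dirichlet_norm_sq \<alpha> f) = (cmod (f 0))\<^sup>2 + x / pi"
    using x unfolding norm by (simp flip: ennreal_mult ennreal_plus)
  have a0: "(cmod (a 0))\<^sup>2 / kernel_coeff \<beta> 0 = (cmod (f 0))\<^sup>2" by (simp add: a_def kernel_coeff_def)
  have C: "1 \<le> (1 + \<beta>) / \<beta>" using \<beta> by (simp add: field_simps)
  have "(\<Sum>n<N. (cmod (a n))\<^sup>2 / kernel_coeff \<beta> n) \<le> (\<Sum>n<Suc N. (cmod (a n))\<^sup>2 / kernel_coeff \<beta> n)"
    using kernel_coeff_pos[OF \<beta>] by (simp add: less_imp_le)
  also have "\<dots> = (cmod (f 0))\<^sup>2 + (\<Sum>n<N. (cmod (a (Suc n)))\<^sup>2 * (1 / kernel_coeff \<beta> (Suc n)))"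
    by (subst sum.lessThan_Suc_shift) (simp add: a0)
  also have "\<dots> \<le> (1 + \<beta>) / \<beta> * (cmod (f 0))\<^sup>2
      + (\<Sum>n<N. (cmod (a (Suc n)))\<^sup>2 * ((1 + \<beta>) / \<beta> * ((real n + 1)\<^sup>2 * Beta (real n + 1) (\<beta> + 1))))"
    using C \<beta> mult_right_mono[OF C, of "(cmod (f 0))\<^sup>2"]
    by (intro add_mono sum_mono mult_left_mono inverse_kernel_coeff_le_moment) auto
  also have "\<dots> = (1 + \<beta>) / \<beta> * ((cmod (f 0))\<^sup>2
      + (\<Sum>n<N. (cmod ((real n + 1) * a (Suc n)))\<^sup>2 * (pi * Beta (real n + 1) (\<beta> + 1))) / pi)"
  proof -
    let ?B = "\<lambda>n. Beta (real n + 1) (\<beta> + 1)" and ?C = "(1 + \<beta>) / \<beta>"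
    have sq: "(cmod ((real n + 1) * a (Suc n)))\<^sup>2 = (real n + 1)\<^sup>2 * (cmod (a (Suc n)))\<^sup>2" for n
      unfolding norm_mult power_mult_distrib norm_of_real by simp
    have "(\<Sum>n<N. (cmod (a (Suc n)))\<^sup>2 * (?C * ((real n + 1)\<^sup>2 * ?B n)))
       = (\<Sum>n<N. ?C * ((cmod ((real n + 1) * a (Suc n)))\<^sup>2 * (pi * ?B n) / pi))"
      unfolding sq by (intro sum.cong refl) simp
    also have "\<dots> = ?C * ((\<Sum>n<N. (cmod ((real n + 1) * a (Suc n)))\<^sup>2 * (pi * ?B n)) / pi)"
      by (simp only: sum_distrib_left sum_divide_distrib)
    finally show ?thesis by (simp only: distrib_left)
  qed
  also have "\<dots> \<le> (1 + \<beta>) / \<beta> * ((cmod (f 0))\<^sup>2 + x / pi)"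
    using series x \<beta> unfolding X_def
    by (intro mult_left_mono add_left_mono divide_right_mono bergman_coefficient_bound) auto
  finally show ?thesis unfolding d a_def \<beta>_def by simp
qed

text \<open>
  Expanding \<open>f\<close> turns the left side into \<open>\<Sum> a\<^sub>n S\<^sub>n\<close> with \<open>S\<^sub>n = \<Sum> c\<^sub>i z\<^sub>i ^ n\<close>. Cauchy-Schwarz with the
  kernel coefficients \<open>\<kappa>\<^sub>n\<close> as weights leaves \<open>\<Sum> \<kappa>\<^sub>n \<bar>S\<^sub>n\<bar>\<^sup>2\<close>, which is the Gram form of the kernel; taking
  absolute values in it removes all phases.
\<close>

lemma dirichlet_duality:
  fixes z :: "'i \<Rightarrow> complex"
  assumes f: "f \<in> dirichlet_space \<alpha>" and \<alpha>: "\<alpha> < 1" and F: "finite F"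
    and z: "\<And>i. i \<in> F \<Longrightarrow> cmod (z i) < 1"
  shows "(cmod (\<Sum>i\<in>F. c i * f (z i)))\<^sup>2
    \<le> (2 - \<alpha>) / (1 - \<alpha>) * enn2real (dirichlet_norm_sq \<alpha> f) *
      (\<Sum>i\<in>F. \<Sum>j\<in>F. cmod (c i) * cmod (c j) * cmod (1 - cnj (z i) * z j) powr (- (1 - \<alpha>)))"
    (is "_ \<le> ?D * ?Q")
proof -
  define \<beta> where "\<beta> = 1 - \<alpha>"
  have \<beta>: "\<beta> > 0" using \<alpha> by (simp add: \<beta>_def)
  define a where "a n = (deriv ^^ n) f 0 / fact n" for n
  define S where "S n = (\<Sum>i\<in>F. c i * z i ^ n)" for n
  note \<kappa> = kernel_coeff_pos[OF \<beta>]
  have hol: "f holomorphic_on unit_disc" using f by (auto simp: dirichlet_space_def)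
  have "(\<lambda>n. a n * z i ^ n) sums f (z i)" if "i \<in> F" for i
    using holomorphic_power_series[OF hol, of "z i"] z[OF that] by (simp add: a_def)
  then have "(\<lambda>n. \<Sum>i\<in>F. c i * (a n * z i ^ n)) sums (\<Sum>i\<in>F. c i * f (z i))"
    by (intro sums_sum sums_mult)
  then have sums: "(\<lambda>n. a n * S n) sums (\<Sum>i\<in>F. c i * f (z i))"
    by (simp add: S_def sum_distrib_left mult_ac)
  have kernel: "(\<Sum>n<N. kernel_coeff \<beta> n * (cmod (S n))\<^sup>2) \<le> ?Q" for N
  proof -
    have lt: "cmod (cnj (z i) * z j) < 1" if "i \<in> F" "j \<in> F" for i j
    proof -
      have "cmod (z i) * cmod (z j) \<le> cmod (z i) * 1"
        using z[OF that(2)] by (intro mult_left_mono) auto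
      then show ?thesis using z[OF that(1)] by (simp add: norm_mult)
    qed
    let ?k = "\<lambda>i j. (1 - cnj (z i) * z j) powr (- of_real \<beta>)"
    have "(\<lambda>n. \<Sum>i\<in>F. \<Sum>j\<in>F. (cnj (c i) * c j) * (of_real (kernel_coeff \<beta> n) * (cnj (z i) * z j) ^ n))
        sums (\<Sum>i\<in>F. \<Sum>j\<in>F. (cnj (c i) * c j) * ?k i j)"
      using lt by (intro sums_sum sums_mult kernel_power_series)
    moreover have "(\<Sum>i\<in>F. \<Sum>j\<in>F. (cnj (c i) * c j) * (of_real (kernel_coeff \<beta> n) * (cnj (z i) * z j) ^ n))
        = of_real (kernel_coeff \<beta> n * (cmod (S n))\<^sup>2)" for n
    proof -
      have "of_real (kernel_coeff \<beta> n * (cmod (S n))\<^sup>2) = of_real (kernel_coeff \<beta> n) * (cnj (S n) * S n)"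
        by (simp only: of_real_mult complex_norm_square mult.commute[of "cnj (S n)"])
      also have "cnj (S n) * S n = (\<Sum>i\<in>F. \<Sum>j\<in>F. cnj (c i * z i ^ n) * (c j * z j ^ n))"
        unfolding S_def cnj_sum by (rule sum_product)
      finally show ?thesis by (simp add: sum_distrib_left power_mult_distrib mult_ac)
    qed
    ultimately have "(\<lambda>n. of_real (kernel_coeff \<beta> n * (cmod (S n))\<^sup>2)) sums (\<Sum>i\<in>F. \<Sum>j\<in>F. (cnj (c i) * c j) * ?k i j)"
      by simp
    from sums_Re[OF this] have sR: "(\<lambda>n. kernel_coeff \<beta> n * (cmod (S n))\<^sup>2) sums Re (\<Sum>i\<in>F. \<Sum>j\<in>F. (cnj (c i) * c j) * ?k i j)"
      by (simp only: Re_complex_of_real)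
    have "(\<Sum>n<N. kernel_coeff \<beta> n * (cmod (S n))\<^sup>2) \<le> (\<Sum>n. kernel_coeff \<beta> n * (cmod (S n))\<^sup>2)"
      using sR \<kappa> by (intro sum_le_suminf) (auto simp: sums_iff less_imp_le)
    also have "\<dots> = Re (\<Sum>i\<in>F. \<Sum>j\<in>F. (cnj (c i) * c j) * ?k i j)"
      using sR by (simp add: sums_iff)
    also have "\<dots> \<le> cmod (\<Sum>i\<in>F. \<Sum>j\<in>F. (cnj (c i) * c j) * ?k i j)" by (rule complex_Re_le_cmod)
    also have "\<dots> \<le> (\<Sum>i\<in>F. \<Sum>j\<in>F. cmod ((cnj (c i) * c j) * ?k i j))"
      by (intro order_trans[OF norm_sum] sum_mono norm_sum)
    also have "\<dots> = ?Q"
      by (intro sum.cong refl) (simp add: norm_mult norm_powr_real_powr' \<beta>_def)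
    finally show ?thesis .
  qed
  have bound: "(cmod (\<Sum>n<N. a n * S n))\<^sup>2 \<le> ?D * ?Q" for N
  proof -
    have "cmod (\<Sum>n<N. a n * S n) \<le> (\<Sum>n<N. (cmod (a n) / sqrt (kernel_coeff \<beta> n)) * (sqrt (kernel_coeff \<beta> n) * cmod (S n)))"
      using \<kappa> by (intro order_trans[OF norm_sum] sum_mono) (simp add: norm_mult less_imp_neq[symmetric])
    then have "(cmod (\<Sum>n<N. a n * S n))\<^sup>2
        \<le> (\<Sum>n<N. (cmod (a n) / sqrt (kernel_coeff \<beta> n)) * (sqrt (kernel_coeff \<beta> n) * cmod (S n)))\<^sup>2"
      by (intro power_mono) auto
    also have "\<dots> \<le> (\<Sum>n<N. (cmod (a n) / sqrt (kernel_coeff \<beta> n))\<^sup>2) * (\<Sum>n<N. (sqrt (kernel_coeff \<beta> n) * cmod (S n))\<^sup>2)"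
      by (rule Cauchy_Schwarz_ineq_sum)
    also have "\<dots> = (\<Sum>n<N. (cmod (a n))\<^sup>2 / kernel_coeff \<beta> n) * (\<Sum>n<N. kernel_coeff \<beta> n * (cmod (S n))\<^sup>2)"
      using \<kappa> by (simp add: power_divide power_mult_distrib less_imp_le)
    also have "\<dots> \<le> ?D * ?Q"
    proof (rule mult_mono)
      show "(\<Sum>n<N. (cmod (a n))\<^sup>2 / kernel_coeff \<beta> n) \<le> ?D"
        unfolding a_def \<beta>_def by (rule dirichlet_coefficient_bound[OF f \<alpha>])
      show "0 \<le> ?D" using \<alpha> by simp
      show "0 \<le> (\<Sum>n<N. kernel_coeff \<beta> n * (cmod (S n))\<^sup>2)"
        using \<kappa> by (intro sum_nonneg) (simp add: less_imp_le)
    qed (rule kernel)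
    finally show ?thesis .
  qed
  have "(\<lambda>N. (cmod (\<Sum>n<N. a n * S n))\<^sup>2) \<longlonglongrightarrow> (cmod (\<Sum>i\<in>F. c i * f (z i)))\<^sup>2"
    using sums by (intro tendsto_intros) (simp add: sums_def)
  then show ?thesis using bound by (intro LIMSEQ_le_const2) auto
qed

section \<open>Dyadic arcs and the size of the kernel\<close>

text \<open>
  The circle is cut into \<open>2 ^ k\<close> half-open arcs of equal length, numbered from the angle \<open>0\<close>.
\<close>

definition arc_index :: "nat \<Rightarrow> real \<Rightarrow> nat" where
  "arc_index k t = nat \<lfloor>2 ^ k * (t / (2 * pi))\<rfloor>"

text \<open>
  Equality or cyclic adjacency. Neighbours have to be admitted because two close points may lie on
  different sides of a dyadic endpoint, at every generation.
\<close>

definition arcs_touch :: "nat \<Rightarrow> nat \<Rightarrow> nat \<Rightarrow> bool" where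
  "arcs_touch k a b \<longleftrightarrow> a = b \<or> b = Suc a mod 2 ^ k \<or> a = Suc b mod 2 ^ k"

lemma arcs_touch_sym: "arcs_touch k a b \<longleftrightarrow> arcs_touch k b a"
  by (auto simp: arcs_touch_def)

lemma arc_index_less: "0 \<le> t \<Longrightarrow> t < 2 * pi \<Longrightarrow> arc_index k t < 2 ^ k"
proof -
  assume t: "0 \<le> t" "t < 2 * pi"
  then have "2 ^ k * (t / (2 * pi)) < 2 ^ k * 1"
    by (intro mult_strict_left_mono) auto
  then have "\<lfloor>2 ^ k * (t / (2 * pi))\<rfloor> < 2 ^ k"
    by (simp add: floor_less_iff)
  then show ?thesis unfolding arc_index_def by (simp add: nat_less_iff t)
qed

text \<open>
  Jordan's inequality: the sine is concave and lies above its chord.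
\<close>

lemma sin_pi_lower:
  assumes "0 \<le> d" "d \<le> 1 / 2"
  shows "2 * d \<le> sin (pi * d)"
proof -
  have "convex_on {0..pi / 2} (\<lambda>x. - sin x)"
  proof (rule f''_ge0_imp_convex)
    show "((\<lambda>x. - sin x) has_real_derivative - cos x) (at x)" for x
      by (auto intro!: derivative_eq_intros)
    show "((\<lambda>x. - cos x) has_real_derivative sin x) (at x)" for x
      by (auto intro!: derivative_eq_intros)
  qed (auto intro: sin_ge_zero)
  from convex_onD[OF this, of "2 * d" 0 "pi / 2"] show ?thesis
    using assms by (simp add: mult.commute)
qed

lemma arcs_not_touch_separated:
  assumes t: "0 \<le> s" "s < 2 * pi" "0 \<le> t" "t < 2 * pi"
    and "\<not> arcs_touch k (arc_index k s) (arc_index k t)"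
  shows "1 / 2 ^ k \<le> \<bar>s - t\<bar> / (2 * pi) \<and> \<bar>s - t\<bar> / (2 * pi) \<le> 1 - 1 / 2 ^ k"
  using assms
proof (induction s t rule: linorder_wlog)
  case (sym s t)
  then show ?case by (simp add: arcs_touch_sym abs_minus_commute)
next
  case (le s t)
  define x y where "x = s / (2 * pi)" and "y = t / (2 * pi)"
  have xy: "0 \<le> x" "x \<le> y" "y < 1" using le by (auto simp: x_def y_def field_simps)
  have d: "\<bar>s - t\<bar> / (2 * pi) = y - x" using le by (simp add: x_def y_def field_simps)
  define K :: int where "K = 2 ^ k"
  define a b where "a = \<lfloor>2 ^ k * x\<rfloor>" and "b = \<lfloor>2 ^ k * y\<rfloor>"
  have ab: "0 \<le> a" "a \<le> b" "b < K"
  proof -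
    show "0 \<le> a" "a \<le> b" using xy by (auto simp: a_def b_def intro!: floor_mono)
    have "2 ^ k * y < 2 ^ k * 1" using xy by (intro mult_strict_left_mono) auto
    then show "b < K" by (simp add: b_def K_def floor_less_iff)
  qed
  have A: "arc_index k s = nat a" "arc_index k t = nat b"
    by (simp_all add: arc_index_def a_def b_def x_def y_def)
  have K: "K = int (2 ^ k)" by (simp add: K_def)
  have 1: "b \<noteq> a" "b \<noteq> a + 1" "\<not> (a = 0 \<and> b = K - 1)"
  proof -
    show "b \<noteq> a" using le A by (auto simp: arcs_touch_def)
    show "b \<noteq> a + 1"
    proof
      assume "b = a + 1"
      then have "nat b = Suc (nat a) mod 2 ^ k"
        using ab K by (simp add: Suc_nat_eq_nat_zadd1 add.commute nat_less_iff)
      then show False using le A by (simp add: arcs_touch_def)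
    qed
    \<comment> \<open>The first and the last arc touch across the angle \<open>0\<close>.\<close>
    show "\<not> (a = 0 \<and> b = K - 1)"
    proof
      assume "a = 0 \<and> b = K - 1"
      then have "int (Suc (nat b)) = int (2 ^ k)" using ab K by simp
      then have "Suc (nat b) = 2 ^ k" by (simp only: of_nat_eq_iff)
      then have "nat a = Suc (nat b) mod 2 ^ k" using \<open>a = 0 \<and> b = K - 1\<close> by simp
      then show False using le A by (simp add: arcs_touch_def)
    qed
  qed
  have fl: "real_of_int a \<le> 2 ^ k * x" "2 ^ k * x < a + 1" "real_of_int b \<le> 2 ^ k * y" "2 ^ k * y < b + 1"
    unfolding a_def b_def by linarith+
  have "real_of_int a + 2 \<le> b" using 1 ab by linarith
  then have l: "1 \<le> 2 ^ k * (y - x)" using fl by (simp add: right_diff_distrib)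
  have "real_of_int b - a \<le> K - 2" using 1 ab by linarith
  then have u: "2 ^ k * (y - x) \<le> 2 ^ k - 1" using fl by (simp add: right_diff_distrib K_def)
  have "1 / 2 ^ k \<le> y - x" using l by (simp add: field_simps)
  moreover have "y - x \<le> 1 - 1 / 2 ^ k" using u by (simp add: field_simps)
  ultimately show ?case by (simp add: d)
qed

lemma norm_one_minus_cis: "cmod (1 - cis x) = 2 * \<bar>sin (x / 2)\<bar>"
proof -
  have "(cmod (1 - cis x))\<^sup>2 = (1 - cos x)\<^sup>2 + (sin x)\<^sup>2"
    by (simp add: cmod_power2)
  also have "\<dots> = 2 - 2 * cos x"
    using sin_cos_squared_add[of x] by (simp add: power2_eq_square algebra_simps)
  also have "cos x = 1 - 2 * (sin (x / 2))\<^sup>2"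
    using cos_double_sin[of "x / 2"] by simp
  finally have "(cmod (1 - cis x))\<^sup>2 = (2 * \<bar>sin (x / 2)\<bar>)\<^sup>2"
    by (simp add: power_mult_distrib)
  then show ?thesis by (subst (asm) power2_eq_iff_nonneg) auto
qed

lemma norm_one_minus_rcis_lower:
  assumes "0 \<le> \<rho>" "\<rho> \<le> 1"
  shows "\<bar>sin (x / 2)\<bar> \<le> cmod (1 - rcis \<rho> x)"
proof -
  have "1 - cis x = (1 - rcis \<rho> x) - of_real (1 - \<rho>) * cis x"
    by (simp add: rcis_def algebra_simps)
  then have "cmod (1 - cis x) \<le> cmod (1 - rcis \<rho> x) + cmod (of_real (1 - \<rho>) * cis x)"
    by (metis norm_triangle_ineq4)
  also have "cmod (of_real (1 - \<rho>) * cis x) = 1 - \<rho>"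
    using assms by (simp only: norm_mult norm_of_real norm_cis) simp
  also have "1 - \<rho> \<le> cmod (1 - rcis \<rho> x)"
    using norm_triangle_ineq2[of 1 "rcis \<rho> x"] assms by simp
  finally show ?thesis by (simp add: norm_one_minus_cis)
qed

text \<open>
  The number of the dyadic annulus \<open>1 - 2 powr (- n) \<le> r < 1 - 2 powr (- n - 1)\<close> that contains \<open>r\<close>; see
  \<open>level_eq_iff\<close>.
\<close>

definition level :: "real \<Rightarrow> nat" where
  "level r = nat \<lfloor>- log 2 (1 - r)\<rfloor>"

lemma level_eq_iff:
  assumes "0 \<le> r" "r < 1"
  shows "level r = n \<longleftrightarrow> 1 - 2 powr (- real n) \<le> r \<and> r < 1 - 2 powr (- real n - 1)"
proof -
  have "log 2 (1 - r) \<le> 0" using assms by (subst log_le_zero_cancel_iff) auto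
  then have "level r = n \<longleftrightarrow> \<lfloor>- log 2 (1 - r)\<rfloor> = int n" by (auto simp: level_def)
  also have "\<dots> \<longleftrightarrow> log 2 (1 - r) \<le> - real n \<and> - real n - 1 < log 2 (1 - r)"
    by (auto simp: floor_eq_iff)
  also have "\<dots> \<longleftrightarrow> 1 - r \<le> 2 powr (- real n) \<and> 2 powr (- real n - 1) < 1 - r"
    using assms by (simp add: log_le_iff less_log_iff)
  finally show ?thesis by auto
qed

text \<open>
  Take the largest \<open>k\<close> up to both levels at which the arcs touch. If \<open>k\<close> is the smaller level, then
  the modulus of that point alone keeps \<open>1 - cnj z * z'\<close> away from \<open>0\<close>. Otherwise the arcs of
  generation \<open>k + 1\<close> do not touch, and the angles are separated at that scale.
\<close>

lemma touching_arcs_at_kernel_scale: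
  assumes t: "0 \<le> s" "s < 2 * pi" "0 \<le> t" "t < 2 * pi"
    and r: "0 \<le> r" "r < 1" "0 \<le> r'" "r' < 1"
  obtains k where "k \<le> level r" "k \<le> level r'" "arcs_touch k (arc_index k s) (arc_index k t)"
    "1 / 2 ^ (k + 1) \<le> cmod (1 - cnj (rcis r s) * rcis r' t)"
proof -
  define N where "N = min (level r) (level r')"
  define A where "A = {k. k \<le> N \<and> arcs_touch k (arc_index k s) (arc_index k t)}"
  define k where "k = Max A"
  have "finite A" by (auto simp: A_def)
  have "arc_index 0 s < 2 ^ 0" "arc_index 0 t < 2 ^ 0" using t by (intro arc_index_less; simp)+
  then have "0 \<in> A" by (simp add: A_def arcs_touch_def)
  then have k: "k \<in> A" unfolding k_def using \<open>finite A\<close> by (intro Max_in) auto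
  have rr: "0 \<le> r * r'" "r * r' \<le> r" "r * r' \<le> r'" "r * r' \<le> 1"
    using r by (auto intro: mult_left_le mult_left_le_one_le mult_le_one)
  have prod: "cnj (rcis r s) * rcis r' t = rcis (r * r') (t - s)"
    by (simp add: rcis_def cis_cnj cis_mult)
  have "1 / 2 ^ (k + 1) \<le> cmod (1 - rcis (r * r') (t - s))"
  proof (cases "k = N")
    case True
    have "1 / 2 ^ (k + 1) \<le> 1 - r * r'"
    proof -
      obtain q where q: "q \<in> {r, r'}" "level q = k"
        using True unfolding N_def min_def by (auto split: if_splits)
      then have "q < 1 - 2 powr (- real k - 1)" using level_eq_iff[of q k] r by auto
      moreover have "2 powr (- real k - 1) = 1 / 2 ^ (k + 1)"
        by (simp add: powr_diff powr_minus powr_realpow field_simps)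
      ultimately show ?thesis using q rr by auto
    qed
    also have "\<dots> \<le> cmod (1 - rcis (r * r') (t - s))"
      using norm_triangle_ineq2[of 1 "rcis (r * r') (t - s)"] rr by simp
    finally show ?thesis .
  next
    case False
    then have "Suc k \<le> N" using k by (auto simp: A_def)
    moreover have "Suc k \<notin> A"
      using Max_ge[OF \<open>finite A\<close>, of "Suc k"] unfolding k_def by auto
    ultimately have "\<not> arcs_touch (Suc k) (arc_index (Suc k) s) (arc_index (Suc k) t)"
      by (auto simp: A_def)
    note sep = arcs_not_touch_separated[OF t this]
    define d where "d = \<bar>s - t\<bar> / (2 * pi)"
    have "1 / 2 ^ (k + 1) \<le> 2 * min d (1 - d)"
    proof -
      define e :: real where "e = 1 / 2 ^ (k + 1)"
      have "0 < e" by (simp add: e_def)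
      moreover have "e \<le> d" "e \<le> 1 - d"
        using sep unfolding d_def[symmetric] e_def by auto
      ultimately show ?thesis unfolding e_def[symmetric] by (simp add: min_def)
    qed
    also have "\<dots> \<le> sin (pi * d)"
    proof (cases "d \<le> 1 / 2")
      case True
      then show ?thesis using sin_pi_lower[of d] t by (simp add: min_def d_def)
    next
      case False
      have "d < 1" using t by (simp add: d_def field_simps abs_if)
      then have "2 * (1 - d) \<le> sin (pi * (1 - d))"
        using False by (intro sin_pi_lower) auto
      also have "sin (pi * (1 - d)) = sin (pi * d)"
        by (simp add: right_diff_distrib sin_diff)
      finally show ?thesis using False by (simp add: min_def)
    qed
    also have "\<dots> \<le> \<bar>sin ((t - s) / 2)\<bar>"
    proof -
      have "pi * d = \<bar>(t - s) / 2\<bar>" by (simp add: d_def field_simps abs_minus_commute)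
      then show ?thesis by (simp add: abs_if)
    qed
    also have "\<dots> \<le> cmod (1 - rcis (r * r') (t - s))"
      using rr by (intro norm_one_minus_rcis_lower) auto
    finally show ?thesis .
  qed
  then show thesis using that[of k] k by (auto simp: A_def N_def prod)
qed

section \<open>The dyadic Schur test\<close>

lemma touching_arcs_card:
  "card {b. b < 2 ^ k \<and> arcs_touch k a b} \<le> 3"
proof -
  have "{b. b < 2 ^ k \<and> arcs_touch k a b} \<subseteq> {a, Suc a mod 2 ^ k, (a + 2 ^ k - 1) mod 2 ^ k}"
  proof
    fix b assume b: "b \<in> {b. b < 2 ^ k \<and> arcs_touch k a b}"
    have "b = (a + 2 ^ k - 1) mod 2 ^ k" if a: "a = Suc b mod 2 ^ k"
    proof (cases "Suc b < 2 ^ k")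
      case True
      then show ?thesis using a by simp
    next
      case False
      then have "Suc b = 2 ^ k" using b by simp
      then show ?thesis using a by (metis add_0 diff_Suc_1 lessI mod_less mod_self)
    qed
    then show "b \<in> {a, Suc a mod 2 ^ k, (a + 2 ^ k - 1) mod 2 ^ k}"
      using b by (auto simp: arcs_touch_def)
  qed
  then have "card {b. b < 2 ^ k \<and> arcs_touch k a b} \<le> card {a, Suc a mod 2 ^ k, (a + 2 ^ k - 1) mod 2 ^ k}"
    by (intro card_mono) auto
  also have "\<dots> \<le> 3"
    by (intro order_trans[OF card_insert_le_m1] order.refl) (auto simp: card_insert_if)
  finally show ?thesis .
qed

text \<open>
  Use \<open>2 * Y a * Y b \<le> (Y a)\<^sup>2 + (Y b)\<^sup>2\<close>; each arc touches at most three arcs.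
\<close>

lemma touching_pairs_sum_le:
  fixes Y :: "nat \<Rightarrow> real"
  shows "(\<Sum>a<2 ^ k. \<Sum>b<2 ^ k. if arcs_touch k a b then Y a * Y b else 0) \<le> 3 * (\<Sum>a<2 ^ k. (Y a)\<^sup>2)"
proof -
  let ?n = "2 ^ k :: nat"
  let ?T = "\<lambda>c a b. if arcs_touch k a b then c else (0::real)"
  have half: "(\<Sum>a<?n. \<Sum>b<?n. ?T ((Y a)\<^sup>2 / 2) a b) \<le> 3 * (\<Sum>a<?n. (Y a)\<^sup>2) / 2"
  proof -
    have "(\<Sum>b<?n. ?T ((Y a)\<^sup>2 / 2) a b) \<le> 3 * ((Y a)\<^sup>2 / 2)" for a
    proof -
      have "(\<Sum>b<?n. ?T ((Y a)\<^sup>2 / 2) a b) = real (card {b. b < ?n \<and> arcs_touch k a b}) * ((Y a)\<^sup>2 / 2)"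
        by (simp flip: sum.inter_filter add: lessThan_def)
      also have "\<dots> \<le> real 3 * ((Y a)\<^sup>2 / 2)"
        using touching_arcs_card[of k a] by (intro mult_right_mono) (simp_all only: of_nat_le_iff, simp)
      finally show ?thesis by simp
    qed
    then have "(\<Sum>a<?n. \<Sum>b<?n. ?T ((Y a)\<^sup>2 / 2) a b) \<le> (\<Sum>a<?n. 3 * ((Y a)\<^sup>2 / 2))"
      by (intro sum_mono)
    then show ?thesis by (simp add: sum_distrib_left sum_divide_distrib)
  qed
  have "(\<Sum>a<?n. \<Sum>b<?n. ?T (Y a * Y b) a b)
     \<le> (\<Sum>a<?n. \<Sum>b<?n. ?T ((Y a)\<^sup>2 / 2) a b + ?T ((Y b)\<^sup>2 / 2) b a)"
  proof (intro sum_mono)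
    fix a b
    have "Y a * Y b \<le> (Y a)\<^sup>2 / 2 + (Y b)\<^sup>2 / 2"
      using sum_squares_bound[of "Y a" "Y b"] by simp
    then show "?T (Y a * Y b) a b \<le> ?T ((Y a)\<^sup>2 / 2) a b + ?T ((Y b)\<^sup>2 / 2) b a"
      by (auto simp: arcs_touch_sym[of k b a])
  qed
  also have "\<dots> = (\<Sum>a<?n. \<Sum>b<?n. ?T ((Y a)\<^sup>2 / 2) a b) + (\<Sum>a<?n. \<Sum>b<?n. ?T ((Y b)\<^sup>2 / 2) b a)"
    by (simp only: sum.distrib)
  also have "(\<Sum>a<?n. \<Sum>b<?n. ?T ((Y b)\<^sup>2 / 2) b a) = (\<Sum>a<?n. \<Sum>b<?n. ?T ((Y a)\<^sup>2 / 2) a b)"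
    by (rule sum.swap)
  finally show ?thesis using half by simp
qed

lemma cauchy_schwarz_weighted:
  fixes y w :: "'i \<Rightarrow> real"
  assumes "\<And>i. i \<in> S \<Longrightarrow> w i > 0"
  shows "(\<Sum>i\<in>S. y i)\<^sup>2 \<le> (\<Sum>i\<in>S. 1 / w i) * (\<Sum>i\<in>S. (y i)\<^sup>2 * w i)"
proof -
  have "(\<Sum>i\<in>S. y i) = (\<Sum>i\<in>S. (1 / sqrt (w i)) * (y i * sqrt (w i)))"
    using assms by (intro sum.cong) (auto simp: less_imp_neq[symmetric])
  also have "\<dots>\<^sup>2 \<le> (\<Sum>i\<in>S. (1 / sqrt (w i))\<^sup>2) * (\<Sum>i\<in>S. (y i * sqrt (w i))\<^sup>2)"
    by (rule Cauchy_Schwarz_ineq_sum)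
  also have "\<dots> = (\<Sum>i\<in>S. 1 / w i) * (\<Sum>i\<in>S. (y i)\<^sup>2 * w i)"
    using assms by (intro arg_cong2[where f="(*)"] sum.cong) (auto simp: power_mult_distrib power_divide less_imp_le)
  finally show ?thesis .
qed

lemma geometric_powr_sum_le:
  fixes \<epsilon> :: real
  assumes "\<epsilon> > 0" "finite A" "A \<subseteq> {k..}"
  shows "(\<Sum>m\<in>A. 2 powr (- \<epsilon> * (real m - real k))) \<le> 1 / (1 - 2 powr (- \<epsilon>))"
proof -
  define q where "q = 2 powr (- \<epsilon>)"
  have q: "0 < q" "q < 1" using assms by (auto simp: q_def powr_less_one)
  have "(\<Sum>m\<in>A. 2 powr (- \<epsilon> * (real m - real k))) = (\<Sum>m\<in>A. q ^ (m - k))"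
    using assms by (intro sum.cong refl)
      (auto simp: q_def powr_powr of_nat_diff simp flip: powr_realpow)
  also have "\<dots> = (\<Sum>j\<in>(\<lambda>m. m - k) ` A. q ^ j)"
    using assms by (subst sum.reindex) (auto intro!: inj_onI simp: subset_iff dest: eq_diff_iff[THEN iffD1, rotated -1])
  also have "\<dots> \<le> (\<Sum>j. q ^ j)"
    using assms q by (intro sum_le_suminf summable_geometric) auto
  also have "\<dots> = 1 / (1 - q)" using q by (intro suminf_geometric) auto
  finally show ?thesis by (simp add: q_def)
qed

text \<open>
  Points with a level and an arc in each generation, abstracted from the disc. \<open>N m\<close> stands for the
  population of level \<open>m\<close>, so that \<open>T\<close> bounds the total mass. In \<open>arc_count\<close> the second summand is the mean
  \<open>N m * 2 powr (- k)\<close>, enlarged by the factor \<open>2 powr (\<epsilon> * k)\<close>; the first allows a few points where the mean is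
  small. Since \<open>\<epsilon>\<close> is at most a third of \<open>\<beta>\<close> and of \<open>1 - \<beta>\<close>, these losses and the weights
  below stay within the available decay.
\<close>

locale sparse_arcs =
  fixes F :: "'i set" and lev :: "'i \<Rightarrow> nat" and arc_of :: "nat \<Rightarrow> 'i \<Rightarrow> nat"
    and N :: "nat \<Rightarrow> real" and K T \<beta> \<epsilon> :: real
  assumes finite_F: "finite F"
    and arc_of_less: "\<And>i k. i \<in> F \<Longrightarrow> arc_of k i < 2 ^ k"
    and eps: "0 < \<epsilon>" "3 * \<epsilon> \<le> \<beta>" "3 * \<epsilon> \<le> 1 - \<beta>"
    and N_nonneg: "\<And>n. 0 \<le> N n"
    and total_mass: "\<And>n. (\<Sum>m<n. N m * 2 powr (- \<beta> * real m)) \<le> T"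
    and K_nonneg: "0 \<le> K"
    and arc_count: "\<And>k m a. k \<le> m \<Longrightarrow> a < 2 ^ k \<Longrightarrow> real (card {i\<in>F. lev i = m \<and> arc_of k i = a})
      \<le> K * (2 powr (\<epsilon> * (real m - real k)) + N m * 2 powr (- (1 - \<epsilon>) * real k))"
begin

text \<open>
  The weight for Cauchy-Schwarz over a box of generation \<open>k\<close>. It has to be summable over
  \<open>k \<le> m\<close> with a bound independent of \<open>m\<close>, while its inverse may grow at most like \<open>2 powr (\<epsilon> * (m - k))\<close>
  against the first summand of \<open>arc_count\<close> and like \<open>2 powr (\<epsilon> * k)\<close> against the second. The sum of the two
  inverse bounds does both.
\<close>

definition box_weight :: "nat \<Rightarrow> nat \<Rightarrow> real" where
  "box_weight k m = 2 powr (- \<epsilon> * (real m - real k)) + 2 powr (- \<epsilon> * real k)"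

abbreviation geo :: real where "geo \<equiv> 1 / (1 - 2 powr (- \<epsilon>))"

definition carleson_box :: "nat \<Rightarrow> nat \<Rightarrow> 'i set" where
  "carleson_box k a = {i\<in>F. k \<le> lev i \<and> arc_of k i = a}"

lemma box_weight_pos: "0 < box_weight k m"
  by (simp add: box_weight_def add_pos_pos)

lemma total_mass_finite:
  assumes "finite A"
  shows "(\<Sum>m\<in>A. N m * 2 powr (- \<beta> * real m)) \<le> T"
proof -
  have "(\<Sum>m\<in>A. N m * 2 powr (- \<beta> * real m)) \<le> (\<Sum>m<Suc (Max (insert 0 A)). N m * 2 powr (- \<beta> * real m))"
    using assms N_nonneg by (intro sum_mono2) (auto simp: less_Suc_eq_le)
  then show ?thesis using total_mass order_trans by blast
qed

text \<open>
  Group the box by levels. Against the first summand of \<open>arc_count\<close> the inverse weight leaves a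
  geometric series in \<open>m - k\<close>; against the second it leaves at most the mass of level \<open>m\<close>, and these
  masses sum to at most \<open>T\<close>.
\<close>

lemma box_weighted_mass_le:
  assumes a: "a < 2 ^ k"
  shows "2 powr (\<beta> * real k) * (\<Sum>i\<in>carleson_box k a. 1 / (2 powr (\<beta> * real (lev i)) * box_weight k (lev i)))
    \<le> K * (geo + T)"
proof -
  let ?A = "lev ` carleson_box k a"
  have fin: "finite (carleson_box k a)" using finite_F by (simp add: carleson_box_def)
  have "(\<Sum>i\<in>carleson_box k a. 1 / (2 powr (\<beta> * real (lev i)) * box_weight k (lev i)))
     = (\<Sum>m\<in>?A. real (card {i\<in>carleson_box k a. lev i = m}) * (1 / (2 powr (\<beta> * real m) * box_weight k m)))"
    using fin by (subst sum.image_gen[of _ _ lev]) auto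
  then have "2 powr (\<beta> * real k) * (\<Sum>i\<in>carleson_box k a. 1 / (2 powr (\<beta> * real (lev i)) * box_weight k (lev i)))
     = (\<Sum>m\<in>?A. 2 powr (\<beta> * real k) * (real (card {i\<in>carleson_box k a. lev i = m}) * (1 / (2 powr (\<beta> * real m) * box_weight k m))))"
    by (simp add: sum_distrib_left)
  also have "\<dots> \<le> (\<Sum>m\<in>?A. K * (2 powr (- \<epsilon> * (real m - real k)) + N m * 2 powr (- \<beta> * real m)))"
  proof (intro sum_mono)
    fix m assume "m \<in> ?A"
    then have km: "k \<le> m" by (auto simp: carleson_box_def)
    have "{i\<in>carleson_box k a. lev i = m} = {i\<in>F. lev i = m \<and> arc_of k i = a}"
      using km by (auto simp: carleson_box_def)
    then have c: "real (card {i\<in>carleson_box k a. lev i = m})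
       \<le> K * (2 powr (\<epsilon> * (real m - real k)) + N m * 2 powr (- (1 - \<epsilon>) * real k))"
      using arc_count[OF km a] by simp
    let ?W = "2 powr (\<beta> * real k) * (1 / (2 powr (\<beta> * real m) * box_weight k m))"
    have W: "?W \<ge> 0" using box_weight_pos[of k m] by simp
    have near: "?W * 2 powr (\<epsilon> * (real m - real k)) \<le> 2 powr (- \<epsilon> * (real m - real k))"
    proof -
      have "?W * 2 powr (\<epsilon> * (real m - real k))
         = 2 powr (\<beta> * real k - \<beta> * real m + \<epsilon> * (real m - real k)) / box_weight k m"
        by (simp add: powr_add powr_diff)
      also have "\<dots> \<le> 2 powr (\<beta> * real k - \<beta> * real m + \<epsilon> * (real m - real k)) / 2 powr (- \<epsilon> * (real m - real k))"
        using box_weight_pos[of k m] by (intro divide_left_mono) (auto simp: box_weight_def)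
      also have "\<dots> = 2 powr (- (\<beta> - 2 * \<epsilon>) * (real m - real k))"
        by (simp add: algebra_simps flip: powr_diff)
      also have "\<dots> \<le> 2 powr (- \<epsilon> * (real m - real k))"
        using eps km by (intro powr_mono mult_right_mono) auto
      finally show ?thesis .
    qed
    have far: "?W * (N m * 2 powr (- (1 - \<epsilon>) * real k)) \<le> N m * 2 powr (- \<beta> * real m)"
    proof -
      have "?W * (N m * 2 powr (- (1 - \<epsilon>) * real k))
         = N m * 2 powr (- \<beta> * real m) * (2 powr (\<beta> * real k - (1 - \<epsilon>) * real k) / box_weight k m)"
        by (simp add: powr_minus powr_diff powr_add field_simps)
      also have "2 powr (\<beta> * real k - (1 - \<epsilon>) * real k) / box_weight k m
         \<le> 2 powr (\<beta> * real k - (1 - \<epsilon>) * real k) / 2 powr (- \<epsilon> * real k)"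
        using box_weight_pos[of k m] by (intro divide_left_mono) (auto simp: box_weight_def)
      also have "\<dots> = 2 powr (- (1 - \<beta> - 2 * \<epsilon>) * real k)"
        by (simp add: algebra_simps flip: powr_diff)
      also have "\<dots> \<le> 2 powr 0"
        using eps by (intro powr_mono mult_nonpos_nonneg) auto
      finally show ?thesis using N_nonneg[of m] by (simp add: mult_left_mono mult_left_le)
    qed
    have "2 powr (\<beta> * real k) * (real (card {i\<in>carleson_box k a. lev i = m}) * (1 / (2 powr (\<beta> * real m) * box_weight k m)))
       = ?W * real (card {i\<in>carleson_box k a. lev i = m})" by simp
    also have "\<dots> \<le> ?W * (K * (2 powr (\<epsilon> * (real m - real k)) + N m * 2 powr (- (1 - \<epsilon>) * real k)))"
      using c W by (rule mult_left_mono)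
    also have "\<dots> = K * (?W * 2 powr (\<epsilon> * (real m - real k)) + ?W * (N m * 2 powr (- (1 - \<epsilon>) * real k)))"
      by (simp only: distrib_left mult_ac)
    also have "\<dots> \<le> K * (2 powr (- \<epsilon> * (real m - real k)) + N m * 2 powr (- \<beta> * real m))"
      using near far K_nonneg by (intro mult_left_mono add_mono)
    finally show "2 powr (\<beta> * real k) * (real (card {i\<in>carleson_box k a. lev i = m}) * (1 / (2 powr (\<beta> * real m) * box_weight k m)))
       \<le> K * (2 powr (- \<epsilon> * (real m - real k)) + N m * 2 powr (- \<beta> * real m))" .
  qed
  also have "\<dots> = K * ((\<Sum>m\<in>?A. 2 powr (- \<epsilon> * (real m - real k))) + (\<Sum>m\<in>?A. N m * 2 powr (- \<beta> * real m)))"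
    by (simp add: sum_distrib_left sum.distrib distrib_left)
  also have "\<dots> \<le> K * (geo + T)"
    using fin eps K_nonneg
    by (intro mult_left_mono add_mono geometric_powr_sum_le total_mass_finite) (auto simp: carleson_box_def)
  finally show ?thesis .
qed

text \<open>
  Weighted Cauchy-Schwarz on each box. A point of level \<open>m\<close> lies in one box of each generation
  \<open>k \<le> m\<close>, and its weights in these boxes have a bounded sum.
\<close>

lemma box_sums_le:
  "(\<Sum>k<L. 2 powr (\<beta> * real k) * (\<Sum>a<2 ^ k. (\<Sum>i\<in>carleson_box k a. y i)\<^sup>2))
    \<le> K * (geo + T) * (2 * geo) * (\<Sum>i\<in>F. (y i)\<^sup>2 * 2 powr (\<beta> * real (lev i)))"
proof -
  have T: "T \<ge> 0" using total_mass[of 0] by simp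
  have geo: "geo \<ge> 0" using eps by (simp add: powr_less_one less_imp_le)
  have C: "K * (geo + T) \<ge> 0" using T geo K_nonneg by simp
  let ?z = "\<lambda>i. (y i)\<^sup>2 * 2 powr (\<beta> * real (lev i))"
  have one: "2 powr (\<beta> * real k) * (\<Sum>i\<in>carleson_box k a. y i)\<^sup>2
      \<le> K * (geo + T) * (\<Sum>i\<in>carleson_box k a. ?z i * box_weight k (lev i))" if "a < 2 ^ k" for k a
  proof -
    have "2 powr (\<beta> * real k) * (\<Sum>i\<in>carleson_box k a. y i)\<^sup>2
      \<le> 2 powr (\<beta> * real k) * ((\<Sum>i\<in>carleson_box k a. 1 / (2 powr (\<beta> * real (lev i)) * box_weight k (lev i)))
        * (\<Sum>i\<in>carleson_box k a. (y i)\<^sup>2 * (2 powr (\<beta> * real (lev i)) * box_weight k (lev i))))"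
      using box_weight_pos by (intro mult_left_mono cauchy_schwarz_weighted) auto
    also have "\<dots> \<le> K * (geo + T) * (\<Sum>i\<in>carleson_box k a. (y i)\<^sup>2 * (2 powr (\<beta> * real (lev i)) * box_weight k (lev i)))"
      unfolding mult.assoc[symmetric, of "2 powr (\<beta> * real k)"]
      using box_weighted_mass_le[OF that] box_weight_pos
      by (intro mult_right_mono sum_nonneg) (auto simp: less_imp_le)
    finally show ?thesis by (simp add: mult.assoc)
  qed
  have level_k: "2 powr (\<beta> * real k) * (\<Sum>a<2 ^ k. (\<Sum>i\<in>carleson_box k a. y i)\<^sup>2)
      \<le> K * (geo + T) * (\<Sum>i\<in>F. if k \<le> lev i then ?z i * box_weight k (lev i) else 0)" for k
  proof -
    have "2 powr (\<beta> * real k) * (\<Sum>a<2 ^ k. (\<Sum>i\<in>carleson_box k a. y i)\<^sup>2)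
       = (\<Sum>a<2 ^ k. 2 powr (\<beta> * real k) * (\<Sum>i\<in>carleson_box k a. y i)\<^sup>2)"
      by (rule sum_distrib_left)
    also have "\<dots> \<le> (\<Sum>a<2 ^ k. K * (geo + T) * (\<Sum>i\<in>carleson_box k a. ?z i * box_weight k (lev i)))"
      using one by (intro sum_mono) auto
    also have "\<dots> = K * (geo + T) * (\<Sum>a<2 ^ k. \<Sum>i\<in>carleson_box k a. ?z i * box_weight k (lev i))"
      by (simp only: sum_distrib_left)
    also have "(\<Sum>a<2 ^ k. \<Sum>i\<in>carleson_box k a. ?z i * box_weight k (lev i))
       = (\<Sum>a<2 ^ k. \<Sum>i\<in>{i\<in>{i\<in>F. k \<le> lev i}. arc_of k i = a}. ?z i * box_weight k (lev i))"
      by (intro sum.cong) (auto simp: carleson_box_def)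
    also have "\<dots> = (\<Sum>i\<in>{i\<in>F. k \<le> lev i}. ?z i * box_weight k (lev i))"
      using finite_F arc_of_less by (intro sum.group) auto
    also have "\<dots> = (\<Sum>i\<in>F. if k \<le> lev i then ?z i * box_weight k (lev i) else 0)"
      using finite_F by (rule sum.inter_filter)
    finally show ?thesis .
  qed
  have weights: "(\<Sum>k<L. if k \<le> m then box_weight k m else 0) \<le> 2 * geo" for m
  proof -
    have "(\<Sum>k<L. if k \<le> m then box_weight k m else 0) \<le> (\<Sum>k\<le>m. box_weight k m)"
      using box_weight_pos by (simp flip: sum.inter_filter) (intro sum_mono2, auto simp: less_imp_le)
    also have "\<dots> = (\<Sum>k\<le>m. 2 powr (- \<epsilon> * (real m - real k))) + (\<Sum>k\<le>m. 2 powr (- \<epsilon> * real k))"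
      by (simp add: box_weight_def sum.distrib)
    also have "(\<Sum>k\<le>m. 2 powr (- \<epsilon> * (real m - real k))) = (\<Sum>k\<le>m. 2 powr (- \<epsilon> * real k))"
      by (rule sum.reindex_bij_witness[of _ "\<lambda>k. m - k" "\<lambda>k. m - k"]) (auto simp: of_nat_diff)
    also have "(\<Sum>k\<le>m. 2 powr (- \<epsilon> * real k)) \<le> geo"
      using geometric_powr_sum_le[OF eps(1), of "{..m}" 0] by simp
    finally show ?thesis by simp
  qed
  have "(\<Sum>k<L. 2 powr (\<beta> * real k) * (\<Sum>a<2 ^ k. (\<Sum>i\<in>carleson_box k a. y i)\<^sup>2))
     \<le> (\<Sum>k<L. K * (geo + T) * (\<Sum>i\<in>F. if k \<le> lev i then ?z i * box_weight k (lev i) else 0))"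
    by (intro sum_mono level_k)
  also have "\<dots> = K * (geo + T) * (\<Sum>k<L. \<Sum>i\<in>F. if k \<le> lev i then ?z i * box_weight k (lev i) else 0)"
    by (simp only: sum_distrib_left)
  also have "(\<Sum>k<L. \<Sum>i\<in>F. if k \<le> lev i then ?z i * box_weight k (lev i) else 0)
     = (\<Sum>i\<in>F. \<Sum>k<L. if k \<le> lev i then ?z i * box_weight k (lev i) else 0)"
    by (rule sum.swap)
  also have "\<dots> = (\<Sum>i\<in>F. ?z i * (\<Sum>k<L. if k \<le> lev i then box_weight k (lev i) else 0))"
    by (simp only: sum_distrib_left if_distrib mult_zero_right)
  also have "K * (geo + T) * \<dots> \<le> K * (geo + T) * (\<Sum>i\<in>F. ?z i * (2 * geo))"
    using weights C by (intro mult_left_mono sum_mono) auto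
  also have "(\<Sum>i\<in>F. ?z i * (2 * geo)) = (\<Sum>i\<in>F. ?z i) * (2 * geo)"
    by (rule sum_distrib_right[symmetric])
  finally show ?thesis by (simp only: mult_ac)
qed

text \<open>
  Bounding \<open>ker i j\<close> by the sum over all admissible \<open>k\<close> makes the quadratic form split into
  generations, and within a generation into pairs of touching boxes.
\<close>

lemma dyadic_schur_bound:
  fixes ker :: "'i \<Rightarrow> 'i \<Rightarrow> real"
  assumes y: "\<And>i. i \<in> F \<Longrightarrow> 0 \<le> y i" and A: "0 \<le> A"
    and ker: "\<And>i j. i \<in> F \<Longrightarrow> j \<in> F \<Longrightarrow> \<exists>k. k \<le> lev i \<and> k \<le> lev j \<and>
       arcs_touch k (arc_of k i) (arc_of k j) \<and> ker i j \<le> A * 2 powr (\<beta> * real k)"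
  shows "(\<Sum>i\<in>F. \<Sum>j\<in>F. y i * y j * ker i j)
    \<le> 3 * A * (K * (geo + T) * (2 * geo)) * (\<Sum>i\<in>F. (y i)\<^sup>2 * 2 powr (\<beta> * real (lev i)))"
proof -
  define L where "L = Suc (Max (insert 0 (lev ` F)))"
  have L: "lev i < L" if "i \<in> F" for i
    using finite_F that by (auto simp: L_def less_Suc_eq_le)
  let ?C = "\<lambda>k i j. k \<le> lev i \<and> k \<le> lev j \<and> arcs_touch k (arc_of k i) (arc_of k j)"
  let ?Y = "\<lambda>k a. \<Sum>i\<in>carleson_box k a. y i"
  have kerL: "ker i j \<le> (\<Sum>k<L. if ?C k i j then A * 2 powr (\<beta> * real k) else 0)"
    if ij: "i \<in> F" "j \<in> F" for i j
  proof -
    obtain k where k: "?C k i j" "ker i j \<le> A * 2 powr (\<beta> * real k)" using ker[OF ij] by auto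
    have "k < L" using k L[OF ij(1)] by auto
    have "ker i j \<le> (if ?C k i j then A * 2 powr (\<beta> * real k) else 0)" using k by simp
    also have "\<dots> \<le> (\<Sum>k<L. if ?C k i j then A * 2 powr (\<beta> * real k) else 0)"
      using \<open>k < L\<close> A by (intro member_le_sum) auto
    finally show ?thesis .
  qed
  have touch: "(\<Sum>i\<in>F. \<Sum>j\<in>F. if ?C k i j then y i * y j else 0)
     = (\<Sum>a<2 ^ k. \<Sum>b<2 ^ k. if arcs_touch k a b then ?Y k a * ?Y k b else 0)" for k
  proof -
    let ?G = "{i\<in>F. k \<le> lev i}"
    have G: "finite ?G" "arc_of k ` ?G \<subseteq> {..<2 ^ k}" using finite_F arc_of_less by auto
    have box: "carleson_box k a = {i\<in>?G. arc_of k i = a}" for a by (auto simp: carleson_box_def)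
    have "(\<Sum>i\<in>F. \<Sum>j\<in>F. if ?C k i j then y i * y j else 0)
       = (\<Sum>i\<in>F. if k \<le> lev i then \<Sum>j\<in>F. if k \<le> lev j then
           if arcs_touch k (arc_of k i) (arc_of k j) then y i * y j else 0 else 0 else 0)"
      by (intro sum.cong refl) (auto intro!: sum.cong sum.neutral)
    also have "\<dots> = (\<Sum>i\<in>?G. \<Sum>j\<in>?G. if arcs_touch k (arc_of k i) (arc_of k j) then y i * y j else 0)"
      using finite_F by (simp only: sum.inter_filter)
    also have "\<dots> = (\<Sum>a<2 ^ k. \<Sum>i\<in>carleson_box k a. \<Sum>b<2 ^ k. \<Sum>j\<in>carleson_box k b.
         if arcs_touch k (arc_of k i) (arc_of k j) then y i * y j else 0)"
      unfolding box using G by (simp only: sum.group finite_lessThan)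
    also have "\<dots> = (\<Sum>a<2 ^ k. \<Sum>b<2 ^ k. \<Sum>i\<in>carleson_box k a. \<Sum>j\<in>carleson_box k b.
         if arcs_touch k a b then y i * y j else 0)"
      by (subst sum.swap, intro sum.cong refl) (auto simp: carleson_box_def)
    also have "\<dots> = (\<Sum>a<2 ^ k. \<Sum>b<2 ^ k. if arcs_touch k a b then ?Y k a * ?Y k b else 0)"
      by (intro sum.cong refl) (simp add: sum_product)
    finally show ?thesis .
  qed
  have "(\<Sum>i\<in>F. \<Sum>j\<in>F. y i * y j * ker i j)
     \<le> (\<Sum>i\<in>F. \<Sum>j\<in>F. y i * y j * (\<Sum>k<L. if ?C k i j then A * 2 powr (\<beta> * real k) else 0))"
    using y kerL by (intro sum_mono mult_left_mono) auto
  also have "\<dots> = (\<Sum>i\<in>F. \<Sum>j\<in>F. \<Sum>k<L. A * 2 powr (\<beta> * real k) * (if ?C k i j then y i * y j else 0))"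
    unfolding sum_distrib_left by (intro sum.cong refl) auto
  also have "\<dots> = (\<Sum>i\<in>F. \<Sum>k<L. \<Sum>j\<in>F. A * 2 powr (\<beta> * real k) * (if ?C k i j then y i * y j else 0))"
    by (intro sum.cong refl sum.swap)
  also have "\<dots> = (\<Sum>k<L. \<Sum>i\<in>F. \<Sum>j\<in>F. A * 2 powr (\<beta> * real k) * (if ?C k i j then y i * y j else 0))"
    by (rule sum.swap)
  also have "\<dots> = (\<Sum>k<L. A * 2 powr (\<beta> * real k) * (\<Sum>i\<in>F. \<Sum>j\<in>F. if ?C k i j then y i * y j else 0))"
    by (simp only: sum_distrib_left)
  also have "\<dots> \<le> (\<Sum>k<L. A * 2 powr (\<beta> * real k) * (3 * (\<Sum>a<2 ^ k. (?Y k a)\<^sup>2)))"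
    unfolding touch using A by (intro sum_mono mult_left_mono touching_pairs_sum_le) auto
  also have "\<dots> = 3 * A * (\<Sum>k<L. 2 powr (\<beta> * real k) * (\<Sum>a<2 ^ k. (?Y k a)\<^sup>2))"
    by (simp add: sum_distrib_left mult_ac)
  also have "\<dots> \<le> 3 * A * (K * (geo + T) * (2 * geo) * (\<Sum>i\<in>F. (y i)\<^sup>2 * 2 powr (\<beta> * real (lev i))))"
    using A by (intro mult_left_mono box_sums_le) auto
  finally show ?thesis by (simp only: mult.assoc)
qed

end

section \<open>Random points in dyadic arcs\<close>

text \<open>
  Markov's inequality for \<open>exp (s * count)\<close>, whose expectation factorises by independence.
\<close>

lemma (in prob_space) count_chernoff:
  fixes X :: "'i \<Rightarrow> 'a \<Rightarrow> real"
  assumes I: "finite I" and ind: "indep_vars (\<lambda>_. borel) X I" and B[measurable]: "B \<in> sets borel"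
    and p: "\<And>i. i \<in> I \<Longrightarrow> prob {\<omega>\<in>space M. X i \<omega> \<in> B} \<le> p" and s: "0 \<le> s"
  shows "prob {\<omega>\<in>space M. t \<le> real (card {i\<in>I. X i \<omega> \<in> B})} \<le> exp (real (card I) * p * exp s - s * t)"
proof -
  have X[measurable]: "X i \<in> borel_measurable M" if "i \<in> I" for i
    using ind that by (auto simp: indep_vars_def)
  define g where "g x = ennreal (exp (s * indicator B x))" for x :: real
  have g[measurable]: "g \<in> borel_measurable borel" unfolding g_def by measurable
  have card: "real (card {i\<in>I. X i \<omega> \<in> B}) = (\<Sum>i\<in>I. indicator B (X i \<omega>))" for \<omega>
    using I by (simp add: indicator_def sum.If_cases Int_def)
  have prod: "ennreal (exp (s * real (card {i\<in>I. X i \<omega> \<in> B}))) = (\<Prod>i\<in>I. g (X i \<omega>))" for \<omega>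
    unfolding card g_def by (simp only: sum_distrib_left exp_sum[OF I]) (simp add: prod_ennreal)
  have single: "(\<integral>\<^sup>+\<omega>. g (X i \<omega>) \<partial>M) \<le> ennreal (exp (p * exp s))" if i: "i \<in> I" for i
  proof -
    let ?E = "{\<omega>\<in>space M. X i \<omega> \<in> B}"
    have E[measurable]: "?E \<in> sets M" using X[OF i] by measurable
    have es: "ennreal (exp s) = 1 + ennreal (exp s - 1)"
      using s by (subst ennreal_1[symmetric], subst ennreal_plus[symmetric]) auto
    have "(\<integral>\<^sup>+\<omega>. g (X i \<omega>) \<partial>M) = (\<integral>\<^sup>+\<omega>. 1 + ennreal (exp s - 1) * indicator ?E \<omega> \<partial>M)"
      by (intro nn_integral_cong) (auto simp: g_def indicator_def es)
    also have "\<dots> = 1 + ennreal (exp s - 1) * emeasure M ?E"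
      by (subst nn_integral_add) (auto simp: nn_integral_cmult emeasure_space_1)
    also have "\<dots> = ennreal (1 + (exp s - 1) * prob ?E)"
      using s by (simp add: emeasure_eq_measure ennreal_mult'[symmetric] ennreal_plus[symmetric] del: ennreal_plus flip: ennreal_1)
    also have "\<dots> \<le> ennreal (exp (p * exp s))"
    proof (rule ennreal_leI)
      have "(exp s - 1) * prob ?E \<le> exp s * p"
        using p[OF i] s by (intro mult_mono) auto
      then have "1 + (exp s - 1) * prob ?E \<le> 1 + p * exp s" by (simp add: mult.commute)
      also have "\<dots> \<le> exp (p * exp s)" by (rule exp_ge_add_one_self)
      finally show "1 + (exp s - 1) * prob ?E \<le> exp (p * exp s)" .
    qed
    finally show ?thesis .
  qed
  let ?S = "{\<omega>\<in>space M. t \<le> real (card {i\<in>I. X i \<omega> \<in> B})}"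
  have Sm[measurable]: "?S \<in> sets M" unfolding card using I X by measurable
  have "ennreal (exp (s * t)) * emeasure M ?S = (\<integral>\<^sup>+\<omega>. ennreal (exp (s * t)) * indicator ?S \<omega> \<partial>M)"
    by (simp add: nn_integral_cmult)
  also have "\<dots> \<le> (\<integral>\<^sup>+\<omega>. (\<Prod>i\<in>I. g (X i \<omega>)) \<partial>M)"
    unfolding prod[symmetric] using s
    by (intro nn_integral_mono) (auto simp: indicator_def intro!: ennreal_leI mult_left_mono)
  also have "\<dots> = (\<Prod>i\<in>I. \<integral>\<^sup>+\<omega>. g (X i \<omega>) \<partial>M)"
    by (rule indep_vars_nn_integral[OF I indep_vars_compose2[OF ind]]) auto
  also have "\<dots> \<le> (\<Prod>i\<in>I. ennreal (exp (p * exp s)))"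
    using single by (intro prod_mono_ennreal) auto
  also have "\<dots> = ennreal (exp (real (card I) * p * exp s))"
    by (simp add: ennreal_power mult.assoc flip: exp_of_nat_mult)
  finally have "exp (s * t) * prob ?S \<le> exp (real (card I) * p * exp s)"
    by (simp add: emeasure_eq_measure flip: ennreal_mult')
  then show ?thesis by (simp add: exp_diff field_simps)
qed

lemma borel_measurable_arc_index [measurable]: "arc_index k \<in> borel \<rightarrow>\<^sub>M count_space UNIV"
  unfolding arc_index_def by measurable

locale uniform_angles = prob_space M for M :: "'w measure" +
  fixes \<theta> :: "nat \<Rightarrow> 'w \<Rightarrow> real"
  assumes indep: "indep_vars (\<lambda>_. borel) \<theta> UNIV"
    and uniform: "distr M borel (\<theta> k) = uniform_measure lborel {0..2 * pi}"
begin

lemma borel_measurable_angle [measurable]: "\<theta> j \<in> borel_measurable M"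
  using indep by (auto simp: indep_vars_def)

lemma emeasure_angle:
  assumes [measurable]: "A \<in> sets borel"
  shows "emeasure M {\<omega>\<in>space M. \<theta> j \<omega> \<in> A} = emeasure lborel ({0..2 * pi} \<inter> A) / ennreal (2 * pi)"
proof -
  have "emeasure M {\<omega>\<in>space M. \<theta> j \<omega> \<in> A} = emeasure (distr M borel (\<theta> j)) A"
    by (subst emeasure_distr) (auto intro!: arg_cong[where f="emeasure M"])
  then show ?thesis by (simp add: uniform emeasure_uniform_measure)
qed

lemma AE_angle_bounds: "AE \<omega> in M. \<forall>j. 0 \<le> \<theta> j \<omega> \<and> \<theta> j \<omega> < 2 * pi"
proof (subst AE_all_countable, intro allI)
  fix j
  have "{0..2 * pi} \<inter> - {0..<2 * pi} = {2 * pi}" by auto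
  then have "emeasure M {\<omega>\<in>space M. \<theta> j \<omega> \<in> - {0..<2 * pi}} = 0"
    by (subst emeasure_angle) auto
  then show "AE \<omega> in M. 0 \<le> \<theta> j \<omega> \<and> \<theta> j \<omega> < 2 * pi"
    by (intro AE_I[where N="{\<omega>\<in>space M. \<theta> j \<omega> \<in> - {0..<2 * pi}}"]) auto
qed

lemma prob_arc_le: "prob {\<omega>\<in>space M. \<theta> j \<omega> \<in> {t. arc_index k t = a}} \<le> 1 / 2 ^ k"
proof -
  let ?I = "{2 * pi * a / 2 ^ k .. 2 * pi * (a + 1) / 2 ^ k}"
  have "{0..2 * pi} \<inter> {t. arc_index k t = a} \<subseteq> ?I"
  proof
    fix t assume t: "t \<in> {0..2 * pi} \<inter> {t. arc_index k t = a}"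
    then have "\<lfloor>2 ^ k * (t / (2 * pi))\<rfloor> = int a" by (auto simp: arc_index_def)
    then have "real a \<le> 2 ^ k * (t / (2 * pi))" "2 ^ k * (t / (2 * pi)) < real a + 1"
      by linarith+
    then show "t \<in> ?I" by (auto simp: field_simps)
  qed
  then have "emeasure lborel ({0..2 * pi} \<inter> {t. arc_index k t = a}) \<le> emeasure lborel ?I"
    by (intro emeasure_mono) auto
  also have "\<dots> = ennreal (2 * pi * (a + 1) / 2 ^ k - 2 * pi * a / 2 ^ k)"
    by (subst emeasure_lborel_Icc) (auto simp: field_simps)
  also have "2 * pi * (a + 1) / 2 ^ k - 2 * pi * a / 2 ^ k = 2 * pi / 2 ^ k"
    by (simp add: field_simps)
  finally have le: "emeasure lborel ({0..2 * pi} \<inter> {t. arc_index k t = a}) \<le> ennreal (2 * pi / 2 ^ k)" .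
  have "{t. arc_index k t = a} \<in> sets borel" by measurable
  then have "ennreal (prob {\<omega>\<in>space M. \<theta> j \<omega> \<in> {t. arc_index k t = a}}) \<le> ennreal (2 * pi / 2 ^ k) / ennreal (2 * pi)"
    unfolding emeasure_eq_measure[symmetric]
    by (subst emeasure_angle) (auto intro!: divide_right_mono_ennreal le)
  also have "\<dots> = ennreal (1 / 2 ^ k)" by (simp add: divide_ennreal)
  finally show ?thesis by simp
qed

text \<open>
  Two equal angles lie in a common arc of every generation \<open>k\<close>, which has probability at most
  \<open>2 ^ k * (1 / 2 ^ k)\<^sup>2\<close>.
\<close>

lemma AE_angles_distinct: "AE \<omega> in M. inj (\<lambda>j. \<theta> j \<omega>)"
proof -
  have pair: "AE \<omega> in M. \<theta> i \<omega> \<noteq> \<theta> j \<omega>" if "i \<noteq> j" for i j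
  proof -
    let ?E = "{\<omega>\<in>space M. (\<forall>j. 0 \<le> \<theta> j \<omega> \<and> \<theta> j \<omega> < 2 * pi) \<and> \<theta> i \<omega> = \<theta> j \<omega>}"
    have [measurable]: "?E \<in> sets M" by measurable
    have "prob ?E \<le> (1 / 2) ^ k" for k
    proof -
      let ?A = "\<lambda>a. {t. arc_index k t = a}"
      have A[measurable]: "?A a \<in> sets borel" for a by measurable
      have "prob ?E \<le> prob (\<Union>a<2 ^ k. {\<omega>\<in>space M. \<theta> i \<omega> \<in> ?A a \<and> \<theta> j \<omega> \<in> ?A a})"
        by (intro finite_measure_mono) (auto intro!: arc_index_less)
      also have "\<dots> \<le> (\<Sum>a<2 ^ k. prob {\<omega>\<in>space M. \<theta> i \<omega> \<in> ?A a \<and> \<theta> j \<omega> \<in> ?A a})"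
        by (intro finite_measure_subadditive_finite) auto
      also have "\<dots> \<le> (\<Sum>a<(2::nat) ^ k. 1 / 2 ^ k * (1 / 2 ^ k))"
      proof (intro sum_mono)
        fix a :: nat
        have "{\<omega>\<in>space M. \<theta> i \<omega> \<in> ?A a \<and> \<theta> j \<omega> \<in> ?A a} = (\<Inter>l\<in>{i, j}. \<theta> l -` ?A a \<inter> space M)"
          by auto
        then have "prob {\<omega>\<in>space M. \<theta> i \<omega> \<in> ?A a \<and> \<theta> j \<omega> \<in> ?A a}
            = (\<Prod>l\<in>{i, j}. prob (\<theta> l -` ?A a \<inter> space M))"
          by (simp only:) (rule indep_varsD[OF indep], auto)
        also have "\<dots> = prob {\<omega>\<in>space M. \<theta> i \<omega> \<in> ?A a} * prob {\<omega>\<in>space M. \<theta> j \<omega> \<in> ?A a}"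
          using that by (simp add: vimage_def Int_def conj_commute)
        also have "\<dots> \<le> 1 / 2 ^ k * (1 / 2 ^ k)" by (intro mult_mono prob_arc_le) auto
        finally show "prob {\<omega>\<in>space M. \<theta> i \<omega> \<in> ?A a \<and> \<theta> j \<omega> \<in> ?A a} \<le> 1 / 2 ^ k * (1 / 2 ^ k)" .
      qed
      also have "\<dots> = (1 / 2) ^ k" by (simp add: power_divide)
      finally show ?thesis .
    qed
    then have "prob ?E \<le> 0"
      by (intro LIMSEQ_le_const[OF LIMSEQ_power_zero[of "1 / 2 :: real"]]) auto
    then have "?E \<in> null_sets M" by (auto simp: emeasure_eq_measure measure_le_0_iff null_sets_def)
    then have "AE \<omega> in M. \<not> ((\<forall>j. 0 \<le> \<theta> j \<omega> \<and> \<theta> j \<omega> < 2 * pi) \<and> \<theta> i \<omega> = \<theta> j \<omega>)"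
      by (intro AE_I'[of ?E]) auto
    with AE_angle_bounds show ?thesis by eventually_elim blast
  qed
  have "AE \<omega> in M. \<forall>i j. i \<noteq> j \<longrightarrow> \<theta> i \<omega> \<noteq> \<theta> j \<omega>"
    unfolding AE_all_countable using pair by auto
  then show ?thesis by eventually_elim (auto simp: inj_def)
qed

text \<open>
  Chernoff with \<open>exp s = 2 powr (\<epsilon> * k)\<close>: the mean times \<open>exp s\<close> is then at most \<open>t / K\<close>, where \<open>t\<close> is the
  threshold, and the exponent is at most \<open>- s * t / 2\<close>. As \<open>t\<close> is at least of size \<open>K * (1 + m - k)\<close> and \<open>s\<close> is of
  size \<open>k\<close>, the product \<open>s * t\<close> is at least of size \<open>K * m\<close>, because \<open>k * (1 + m - k) \<ge> m\<close> for \<open>1 \<le> k \<le> m\<close>.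
  The lower bound on \<open>K\<close> makes the probability \<open>8 powr (- m)\<close>, which beats the number of arcs.
\<close>

lemma prob_crowded_arc_le:
  assumes I: "finite I" and eps: "0 < \<epsilon>" "\<epsilon> \<le> 1" and k: "1 \<le> k" "k \<le> m"
    and K: "6 / (\<epsilon> * ln 2)\<^sup>2 * ln 2 \<le> K"
  shows "prob {\<omega>\<in>space M. K * (2 powr (\<epsilon> * (real m - real k)) + real (card I) * 2 powr (- (1 - \<epsilon>) * real k))
       \<le> real (card {j\<in>I. \<theta> j \<omega> \<in> {t. arc_index k t = a}})} \<le> 1 / 8 ^ m"
proof -
  define l where "l = \<epsilon> * ln 2"
  define t where "t = K * (2 powr (\<epsilon> * (real m - real k)) + real (card I) * 2 powr (- (1 - \<epsilon>) * real k))"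
  \<comment> \<open>\<open>exp s\<close> is the factor \<open>2 powr (\<epsilon> * k)\<close> that the threshold leaves above the mean.\<close>
  define s where "s = l * real k"
  have l: "0 < l" "l \<le> 1" using eps ln_2_less_1 by (auto simp: l_def intro: mult_le_one)
  have K': "6 * ln 2 \<le> K * l\<^sup>2" using K l by (simp add: l_def[symmetric] field_simps)
  have K0: "K > 0" using K l by (simp add: l_def[symmetric]) (smt (verit) divide_pos_pos ln_gt_zero mult_pos_pos zero_less_power)
  have s: "0 \<le> s" using l by (simp add: s_def)
  have sl: "l \<le> s" using l k by (simp add: s_def)
  have es: "exp s = 2 powr (\<epsilon> * real k)" by (simp add: s_def l_def powr_def mult_ac)
  have tN: "real (card I) * (1 / 2 ^ k) * exp s \<le> t / K"
  proof -
    have "real (card I) * (1 / 2 ^ k) * exp s = real (card I) * 2 powr (- (1 - \<epsilon>) * real k)"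
      unfolding es by (simp add: left_diff_distrib powr_diff powr_realpow)
    then show ?thesis using K0 by (simp add: t_def)
  qed
  have tK: "K * 2 powr (\<epsilon> * (real m - real k)) \<le> t" using K0 by (simp add: t_def)
  have t0: "0 < t" using tK K0 by (smt (verit) mult_pos_pos powr_gt_zero)
  have Kl: "2 \<le> K * l"
  proof -
    have "1 / 2 \<le> ln (2::real)" using ln2_ge_two_thirds by simp
    then have "2 \<le> K * l\<^sup>2" using K' by linarith
    also have "\<dots> \<le> K * l" using l K0 by (simp add: power2_eq_square mult_left_le)
    finally show ?thesis .
  qed
  have exponent: "real m * (3 * ln 2) \<le> s * t - t / K"
  proof -
    have "l * (1 + (real m - real k)) \<le> 1 + l * (real m - real k)"
      using l by (simp add: distrib_left)
    also have "\<dots> \<le> exp (l * (real m - real k))" by (rule exp_ge_add_one_self)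
    also have "\<dots> = 2 powr (\<epsilon> * (real m - real k))" by (simp add: l_def powr_def mult_ac)
    finally have e: "K * (l * (1 + (real m - real k))) \<le> t" using tK K0
      by (meson mult_left_mono less_imp_le order_trans)
    have "real m \<le> real k * (1 + (real m - real k))"
    proof -
      have "0 \<le> (real k - 1) * (real m - real k)" using k by (intro mult_nonneg_nonneg) auto
      then show ?thesis by (simp add: algebra_simps)
    qed
    then have "real m * (3 * ln 2) \<le> real k * (1 + (real m - real k)) * (3 * ln 2)"
      by (intro mult_right_mono) auto
    also have "\<dots> \<le> real k * (1 + (real m - real k)) * (K * l\<^sup>2 / 2)"
      using K' k by (intro mult_left_mono) auto
    also have "\<dots> = (s / 2) * (K * (l * (1 + (real m - real k))))"
      by (simp add: s_def power2_eq_square)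
    also have "\<dots> \<le> (s / 2) * t" using e s by (intro mult_left_mono) auto
    also have "\<dots> \<le> s * t - t / K"
    proof -
      have "2 \<le> K * s" using Kl sl K0 by (meson mult_left_mono less_imp_le order_trans)
      then have "t / K \<le> (s / 2) * t" using K0 t0 by (simp add: field_simps)
      then show ?thesis by simp
    qed
    finally show ?thesis .
  qed
  have "prob {\<omega>\<in>space M. t \<le> real (card {j\<in>I. \<theta> j \<omega> \<in> {t. arc_index k t = a}})}
      \<le> exp (real (card I) * (1 / 2 ^ k) * exp s - s * t)"
    using I s by (intro count_chernoff indep_vars_subset[OF indep] prob_arc_le) auto
  also have "\<dots> \<le> exp (real m * (- (3 * ln 2)))" using tN exponent by simp
  also have "\<dots> = exp (- (3 * ln 2)) ^ m" by (rule exp_of_nat_mult)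
  also have "exp (- (3 * ln 2)) = (1 / 8 :: real)"
    using exp_of_nat_mult[of 3 "ln 2 :: real"] by (simp add: exp_minus inverse_eq_divide)
  finally show ?thesis by (simp add: t_def power_divide)
qed

text \<open>
  By Borel-Cantelli only finitely many levels \<open>m\<close> violate the bound with the deterministic constant
  of \<open>prob_crowded_arc_le\<close>. These levels contain finitely many points, which a larger, random
  constant absorbs.
\<close>

lemma AE_arc_counts_bounded:
  fixes I :: "nat \<Rightarrow> nat set"
  assumes I: "\<And>m. finite (I m)" and eps: "0 < \<epsilon>" "\<epsilon> \<le> 1"
  shows "AE \<omega> in M. \<exists>K\<ge>0. \<forall>m k a. k \<le> m \<longrightarrow>
     real (card {j\<in>I m. arc_index k (\<theta> j \<omega>) = a})
       \<le> K * (2 powr (\<epsilon> * (real m - real k)) + real (card (I m)) * 2 powr (- (1 - \<epsilon>) * real k))"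
proof -
  define K where "K = 6 / (\<epsilon> * ln 2)\<^sup>2 * ln 2"
  have K0: "K \<ge> 0" by (simp add: K_def)
  define b where "b m k = 2 powr (\<epsilon> * (real m - real k)) + real (card (I m)) * 2 powr (- (1 - \<epsilon>) * real k)" for m k
  define E where "E m k a = {\<omega>\<in>space M. K * b m k \<le> real (card {j\<in>I m. \<theta> j \<omega> \<in> {t. arc_index k t = a}})}" for m k a
  define Bad where "Bad m = (\<Union>k\<in>{1..m}. \<Union>a<2 ^ k. E m k a)" for m
  have count: "real (card {j\<in>I m. \<theta> j \<omega> \<in> A}) = (\<Sum>j\<in>I m. indicator A (\<theta> j \<omega>))" for m \<omega> A
    using I by (simp add: indicator_def sum.If_cases Int_def)
  have E[measurable]: "E m k a \<in> sets M" for m k a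
    unfolding E_def count by measurable
  have Bad[measurable]: "Bad m \<in> sets M" for m unfolding Bad_def by measurable
  have prob: "prob (Bad m) \<le> (1 / 2) ^ m" for m
  proof -
    have "prob (Bad m) \<le> (\<Sum>k\<in>{1..m}. prob (\<Union>a<2 ^ k. E m k a))"
      unfolding Bad_def by (intro finite_measure_subadditive_finite) auto
    also have "\<dots> \<le> (\<Sum>k\<in>{1..m}. \<Sum>a<2 ^ k. prob (E m k a))"
      by (intro sum_mono finite_measure_subadditive_finite) auto
    also have "\<dots> \<le> (\<Sum>k\<in>{1..m}. \<Sum>a<(2::nat) ^ k. 1 / 8 ^ m)"
      unfolding E_def b_def using I eps by (intro sum_mono prob_crowded_arc_le) (auto simp: K_def)
    also have "\<dots> = (\<Sum>k\<in>{1..m}. 2 ^ k / 8 ^ m)" by simp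
    also have "\<dots> \<le> (\<Sum>k\<in>{1..m}. 2 ^ m / 8 ^ m)"
      by (intro sum_mono divide_right_mono power_increasing) auto
    also have "\<dots> = real m * (2 ^ m / 8 ^ m)" by simp
    also have "\<dots> \<le> 2 ^ m * (2 ^ m / 8 ^ m)"
      by (intro mult_right_mono less_imp_le of_nat_less_two_power) auto
    also have "\<dots> = (1 / 2) ^ m"
    proof -
      have "(8::real) ^ m = 2 ^ m * (2 ^ m * 2 ^ m)" by (simp flip: power_mult_distrib)
      then show ?thesis by (simp add: power_divide)
    qed
    finally show ?thesis .
  qed
  have "AE \<omega> in M. eventually (\<lambda>m. \<omega> \<in> space M - Bad m) sequentially"
  proof (rule borel_cantelli_AE1[OF Bad])
    show "summable (\<lambda>m. prob (Bad m))"
      using prob by (intro summable_comparison_test'[OF summable_geometric[of "1/2"]]) auto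
  qed (simp add: emeasure_eq_measure)
  then show ?thesis
    using AE_angle_bounds
  proof eventually_elim
    case (elim \<omega>)
    then obtain m0 where m0: "\<And>m. m \<ge> m0 \<Longrightarrow> \<omega> \<in> space M - Bad m"
      by (auto simp: eventually_sequentially)
    \<comment> \<open>Levels below \<open>m0\<close> may be bad; their whole population goes into the constant.
        The summand \<open>1\<close> covers generation \<open>0\<close>, where the only arc contains all points.\<close>
    define K' where "K' = K + 1 + (\<Sum>m<m0. real (card (I m)))"
    have KK: "K \<le> K'" "1 \<le> K'" "\<And>m. m < m0 \<Longrightarrow> real (card (I m)) \<le> K'"
    proof -
      have S: "0 \<le> (\<Sum>m<m0. real (card (I m)))" by (intro sum_nonneg) auto
      then show "K \<le> K'" "1 \<le> K'" using K0 by (auto simp: K'_def)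
      fix m assume "m < m0"
      then have "real (card (I m)) \<le> (\<Sum>m<m0. real (card (I m)))"
        by (intro member_le_sum) auto
      then show "real (card (I m)) \<le> K'" using K0 by (simp add: K'_def)
    qed
    have b0: "b m k \<ge> 0" for m k by (simp add: b_def)
    have "real (card {j\<in>I m. arc_index k (\<theta> j \<omega>) = a}) \<le> K' * b m k" if km: "k \<le> m" for m k a
    proof -
      have triv: "real (card {j\<in>I m. arc_index k (\<theta> j \<omega>) = a}) \<le> real (card (I m))"
        using I by (auto intro!: card_mono)
      consider "m < m0" | "k = 0" | "a \<ge> 2 ^ k" | "m \<ge> m0" "1 \<le> k" "a < 2 ^ k" by linarith
      then show ?thesis
      proof cases
        case 1
        have "1 \<le> b m k"
        proof -
          have "2 powr 0 \<le> 2 powr (\<epsilon> * (real m - real k))" using eps km by (intro powr_mono) auto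
          then show ?thesis by (simp add: b_def add_increasing2)
        qed
        then have "K' * 1 \<le> K' * b m k" using KK by (intro mult_left_mono) auto
        then show ?thesis using triv KK(3)[OF 1] by linarith
      next
        case 2
        have "real (card (I m)) \<le> 1 * b m k" using 2 by (simp add: b_def)
        also have "\<dots> \<le> K' * b m k" using KK b0 by (intro mult_right_mono) auto
        finally show ?thesis using triv by linarith
      next
        case 3
        have "arc_index k (\<theta> j \<omega>) < 2 ^ k" for j using elim(2) by (intro arc_index_less) auto
        then have none: "arc_index k (\<theta> j \<omega>) \<noteq> a" for j using 3 by (metis not_less)
        show ?thesis using KK b0 by (simp add: none)
      next
        case 4
        then have "\<omega> \<notin> E m k a" using m0[of m] km by (auto simp: Bad_def)
        then have "real (card {j\<in>I m. arc_index k (\<theta> j \<omega>) = a}) \<le> K * b m k"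
          using m0[of m] 4 by (auto simp: E_def)
        also have "\<dots> \<le> K' * b m k" using KK b0 by (intro mult_right_mono) auto
        finally show ?thesis .
      qed
    qed
    then show ?case unfolding b_def using KK by (intro exI[of _ K']) auto
  qed
qed

end

section \<open>The Carleson inequality\<close>

lemma rcis_eq_imp:
  assumes "rcis r s = rcis r' t" "0 \<le> r" "0 \<le> r'" "0 \<le> s" "s < 2 * pi" "0 \<le> t" "t < 2 * pi"
  shows "r = r' \<and> (r = 0 \<or> s = t)"
proof -
  have r: "r = r'" using arg_cong[OF assms(1), of cmod] assms(2,3) by simp
  have "s = t" if "r \<noteq> 0"
  proof -
    have "Arg2pi (rcis r s) = s" "Arg2pi (rcis r s) = t"
      using assms r that by (auto intro!: Arg2pi_unique simp: rcis_def cis_conv_exp)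
    then show ?thesis by simp
  qed
  then show ?thesis using r by auto
qed

text \<open>
  The product of the norm comparison of \<open>dirichlet_duality\<close>, the Schur constant of
  \<open>dyadic_schur_bound\<close> with \<open>A = 2 powr (1 - \<alpha>)\<close>, and the bound \<open>2 powr (1 - \<alpha>)\<close> for the ratio between the
  mass of a point and its dyadic value.
\<close>

definition carleson_const :: "real \<Rightarrow> real \<Rightarrow> real \<Rightarrow> real \<Rightarrow> real" where
  "carleson_const \<alpha> \<epsilon> K T = (2 - \<alpha>) / (1 - \<alpha>) *
     (3 * 2 powr (1 - \<alpha>) * (K * (1 / (1 - 2 powr (- \<epsilon>)) + T) * (2 * (1 / (1 - 2 powr (- \<epsilon>))))) * 2 powr (1 - \<alpha>))"

text \<open>
  Let \<open>S\<close> be the left side. Duality with \<open>c\<^sub>i = m\<^sub>i cnj (f z\<^sub>i)\<close> gives \<open>S\<^sup>2\<close> on the left, and the Schur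
  bound gives a multiple of \<open>S\<close> times the Dirichlet norm on the right; then divide by \<open>S\<close>, which is
  finite because the sum is.
\<close>

lemma finite_carleson_bound:
  fixes r t :: "nat \<Rightarrow> real"
  assumes f: "f \<in> dirichlet_space \<alpha>" and \<alpha>: "0 < \<alpha>" "\<alpha> < 1"
    and r: "\<And>i. 0 \<le> r i \<and> r i < 1" and t: "\<And>i. 0 \<le> t i \<and> t i < 2 * pi"
    and sparse: "sparse_arcs F (\<lambda>i. level (r i)) (\<lambda>k i. arc_index k (t i)) N K T (1 - \<alpha>) \<epsilon>"
  shows "(\<Sum>i\<in>F. (1 - (r i)\<^sup>2) powr (1 - \<alpha>) * (cmod (f (rcis (r i) (t i))))\<^sup>2)
    \<le> carleson_const \<alpha> \<epsilon> K T * enn2real (dirichlet_norm_sq \<alpha> f)"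
proof -
  interpret sparse_arcs F "\<lambda>i. level (r i)" "\<lambda>k i. arc_index k (t i)" N K T "1 - \<alpha>" \<epsilon> by (rule sparse)
  define m where "m i = (1 - (r i)\<^sup>2) powr (1 - \<alpha>)" for i
  define z where "z i = rcis (r i) (t i)" for i
  define y where "y i = m i * cmod (f (z i))" for i
  define S where "S = (\<Sum>i\<in>F. m i * (cmod (f (z i)))\<^sup>2)"
  define d where "d = enn2real (dirichlet_norm_sq \<alpha> f)"
  define D where "D = 3 * 2 powr (1 - \<alpha>) * (K * (geo + T) * (2 * geo))"
  have d: "d \<ge> 0" by (simp add: d_def)
  have m0: "m i \<ge> 0" for i by (simp add: m_def)
  have S0: "S \<ge> 0" unfolding S_def using m0 by (intro sum_nonneg) auto
  have T: "T \<ge> 0" using total_mass[of 0] by simp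
  have geo: "geo \<ge> 0" using eps by (simp add: powr_less_one less_imp_le)
  have D: "D \<ge> 0" using T geo K_nonneg by (simp add: D_def)
  have z: "cmod (z i) < 1" for i using r by (simp add: z_def)
  have mass: "m i * 2 powr ((1 - \<alpha>) * real (level (r i))) \<le> 2 powr (1 - \<alpha>)" for i
  proof -
    have "1 - r i \<le> 2 powr (- real (level (r i)))"
      using level_eq_iff[of "r i" "level (r i)"] r[of i] by auto
    then have "(1 - r i) * 2 powr real (level (r i)) \<le> 1"
      by (simp add: powr_minus field_simps)
    moreover have "1 - (r i)\<^sup>2 \<le> 2 * (1 - r i)"
    proof -
      have "0 \<le> (1 - r i)\<^sup>2" by simp
      then show ?thesis by (simp add: power2_eq_square algebra_simps)
    qed
    then have "(1 - (r i)\<^sup>2) * 2 powr real (level (r i)) \<le> 2 * (1 - r i) * 2 powr real (level (r i))"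
      by (rule mult_right_mono) simp
    ultimately have le: "(1 - (r i)\<^sup>2) * 2 powr real (level (r i)) \<le> 2" by linarith
    have r2: "0 \<le> 1 - (r i)\<^sup>2" using r[of i] by (simp add: abs_square_le_1)
    have "m i * 2 powr ((1 - \<alpha>) * real (level (r i))) = ((1 - (r i)\<^sup>2) * 2 powr real (level (r i))) powr (1 - \<alpha>)"
      using r2 by (simp add: m_def powr_mult powr_powr mult.commute)
    also have "\<dots> \<le> 2 powr (1 - \<alpha>)" using le r2 \<alpha> by (intro powr_mono2) auto
    finally show ?thesis .
  qed
  have ker: "\<exists>k. k \<le> level (r i) \<and> k \<le> level (r j) \<and> arcs_touch k (arc_index k (t i)) (arc_index k (t j)) \<and>
      cmod (1 - cnj (z i) * z j) powr (- (1 - \<alpha>)) \<le> 2 powr (1 - \<alpha>) * 2 powr ((1 - \<alpha>) * real k)" for i j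
  proof -
    obtain k where k: "k \<le> level (r i)" "k \<le> level (r j)" "arcs_touch k (arc_index k (t i)) (arc_index k (t j))"
      and low: "1 / 2 ^ (k + 1) \<le> cmod (1 - cnj (z i) * z j)"
      unfolding z_def using touching_arcs_at_kernel_scale[of "t i" "t j" "r i" "r j"] r t by metis
    have "cmod (1 - cnj (z i) * z j) powr (- (1 - \<alpha>)) \<le> (1 / 2 ^ (k + 1)) powr (- (1 - \<alpha>))"
      using low \<alpha> by (intro powr_mono2') auto
    also have "(1 / 2 ^ (k + 1) :: real) = 2 powr (- (1 + real k))"
    proof -
      have e: "- (1 + real k) = - real (k + 1)" by simp
      show ?thesis unfolding e powr_minus by (subst powr_realpow) (auto simp: inverse_eq_divide)
    qed
    also have "(2 powr (- (1 + real k))) powr (- (1 - \<alpha>)) = 2 powr (1 - \<alpha>) * 2 powr ((1 - \<alpha>) * real k)"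
      unfolding powr_powr powr_add[symmetric] by (simp add: algebra_simps)
    finally show ?thesis using k by blast
  qed
  have "S\<^sup>2 = (cmod (\<Sum>i\<in>F. (of_real (m i) * cnj (f (z i))) * f (z i)))\<^sup>2"
  proof -
    have "(\<Sum>i\<in>F. (of_real (m i) * cnj (f (z i))) * f (z i)) = of_real S"
      unfolding S_def of_real_sum of_real_mult complex_norm_square by (intro sum.cong refl) simp
    then show ?thesis by simp
  qed
  also have "\<dots> \<le> (2 - \<alpha>) / (1 - \<alpha>) * d *
      (\<Sum>i\<in>F. \<Sum>j\<in>F. cmod (of_real (m i) * cnj (f (z i))) * cmod (of_real (m j) * cnj (f (z j)))
        * cmod (1 - cnj (z i) * z j) powr (- (1 - \<alpha>)))"
    unfolding d_def using z by (intro dirichlet_duality[OF f \<alpha>(2) finite_F])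
  also have "\<dots> = (2 - \<alpha>) / (1 - \<alpha>) * d *
      (\<Sum>i\<in>F. \<Sum>j\<in>F. y i * y j * cmod (1 - cnj (z i) * z j) powr (- (1 - \<alpha>)))"
    using m0 by (simp add: y_def norm_mult)
  also have "\<dots> \<le> (2 - \<alpha>) / (1 - \<alpha>) * d * (D * (\<Sum>i\<in>F. (y i)\<^sup>2 * 2 powr ((1 - \<alpha>) * real (level (r i)))))"
    unfolding D_def using \<alpha> d m0 ker
    by (intro mult_left_mono dyadic_schur_bound) (auto simp: y_def)
  also have "\<dots> \<le> (2 - \<alpha>) / (1 - \<alpha>) * d * (D * (2 powr (1 - \<alpha>) * S))"
  proof -
    have "(y i)\<^sup>2 * 2 powr ((1 - \<alpha>) * real (level (r i))) \<le> 2 powr (1 - \<alpha>) * (m i * (cmod (f (z i)))\<^sup>2)" for i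
    proof -
      have "(m i * (cmod (f (z i)))\<^sup>2) * (m i * 2 powr ((1 - \<alpha>) * real (level (r i))))
         \<le> (m i * (cmod (f (z i)))\<^sup>2) * 2 powr (1 - \<alpha>)"
        using mass m0 by (intro mult_left_mono) auto
      then show ?thesis by (simp add: y_def power2_eq_square mult_ac)
    qed
    then have "(\<Sum>i\<in>F. (y i)\<^sup>2 * 2 powr ((1 - \<alpha>) * real (level (r i)))) \<le> 2 powr (1 - \<alpha>) * S"
      unfolding S_def sum_distrib_left by (intro sum_mono)
    then show ?thesis using \<alpha> d D by (intro mult_left_mono) auto
  qed
  also have "\<dots> = (carleson_const \<alpha> \<epsilon> K T * d) * S"
    by (simp add: D_def carleson_const_def mult_ac)
  finally have "S * S \<le> (carleson_const \<alpha> \<epsilon> K T * d) * S" by (simp add: power2_eq_square)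
  moreover have "carleson_const \<alpha> \<epsilon> K T = (2 - \<alpha>) / (1 - \<alpha>) * (D * 2 powr (1 - \<alpha>))"
    by (simp only: carleson_const_def D_def)
  then have "carleson_const \<alpha> \<epsilon> K T * d \<ge> 0"
    using D d \<alpha> by (simp del: times_divide_eq_left)
  ultimately have "S \<le> carleson_const \<alpha> \<epsilon> K T * d"
    using S0 by (cases "S = 0") auto
  then show ?thesis by (simp add: S_def m_def z_def d_def)
qed

lemma nn_integral_point_mass_measure:
  assumes "\<Lambda> \<subseteq> unit_disc" and "f holomorphic_on unit_disc"
  shows "(\<integral>\<^sup>+w. ennreal ((cmod (f w))\<^sup>2) \<partial>point_mass_measure \<alpha> \<Lambda>)
    = (\<integral>\<^sup>+w. ennreal ((1 - (cmod w)\<^sup>2) powr (1 - \<alpha>) * (cmod (f w))\<^sup>2) \<partial>count_space \<Lambda>)"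
proof -
  let ?D = "density (count_space \<Lambda>) (\<lambda>z. ennreal ((1 - (cmod z)\<^sup>2) powr (1 - \<alpha>)))"
  have "(\<lambda>z. z) \<in> ?D \<rightarrow>\<^sub>M restrict_space borel unit_disc"
    using assms(1) by (auto simp: measurable_def space_restrict_space)
  moreover have "f \<in> borel_measurable (restrict_space borel unit_disc)"
    using assms(2) by (intro borel_measurable_continuous_on_restrict holomorphic_on_imp_continuous_on)
  then have "(\<lambda>w. ennreal ((cmod (f w))\<^sup>2)) \<in> borel_measurable (restrict_space borel unit_disc)"
    by measurable
  ultimately have "(\<integral>\<^sup>+w. ennreal ((cmod (f w))\<^sup>2) \<partial>point_mass_measure \<alpha> \<Lambda>) = (\<integral>\<^sup>+w. ennreal ((cmod (f w))\<^sup>2) \<partial>?D)"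
    unfolding point_mass_measure_def by (subst nn_integral_distr) auto
  also have "\<dots> = (\<integral>\<^sup>+w. ennreal ((1 - (cmod w)\<^sup>2) powr (1 - \<alpha>) * (cmod (f w))\<^sup>2) \<partial>count_space \<Lambda>)"
    by (subst nn_integral_density) (auto simp: ennreal_mult')
  finally show ?thesis .
qed

lemma nn_integral_count_space_le:
  fixes g :: "nat \<Rightarrow> real"
  assumes "\<And>F. finite F \<Longrightarrow> F \<subseteq> J \<Longrightarrow> sum g F \<le> c" and "\<And>j. 0 \<le> g j"
  shows "(\<integral>\<^sup>+j. ennreal (g j) \<partial>count_space J) \<le> ennreal c"
proof -
  have "(\<integral>\<^sup>+j. ennreal (g j) \<partial>count_space J) = (\<integral>\<^sup>+j. ennreal (g j) * indicator J j \<partial>count_space UNIV)"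
    by (rule nn_integral_count_space_indicator) simp
  also have "\<dots> = (\<Sum>j. ennreal (g j) * indicator J j)" by (rule nn_integral_count_space_nat)
  also have "\<dots> = (SUP n. \<Sum>j<n. ennreal (g j) * indicator J j)" by (rule suminf_eq_SUP)
  also have "\<dots> \<le> ennreal c"
  proof (rule SUP_least)
    fix n
    have "(\<Sum>j<n. ennreal (g j) * indicator J j) = (\<Sum>j\<in>{..<n} \<inter> J. ennreal (g j))"
      by (simp add: sum.inter_restrict indicator_def if_distrib cong: if_cong)
    also have "\<dots> = ennreal (sum g ({..<n} \<inter> J))" using assms(2) by (intro sum_ennreal) auto
    also have "\<dots> \<le> ennreal c" by (intro ennreal_leI assms(1)) auto
    finally show "(\<Sum>j<n. ennreal (g j) * indicator J j) \<le> ennreal c" .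
  qed
  finally show ?thesis .
qed

text \<open>
  Indices of radius \<open>0\<close> all give the same point, whatever their angles, so only the first of them is
  kept. Almost surely there are no other coincidences, and this set of indices is deterministic.
\<close>

definition distinct_indices :: "(nat \<Rightarrow> real) \<Rightarrow> nat set" where
  "distinct_indices \<rho> = {j. \<rho> j = 0 \<longrightarrow> (\<forall>i<j. \<rho> i \<noteq> 0)}"

definition level_indices :: "(nat \<Rightarrow> real) \<Rightarrow> nat \<Rightarrow> nat set" where
  "level_indices \<rho> n = {j\<in>distinct_indices \<rho>. level (\<rho> j) = n}"

lemma random_points_distinct_indices:
  assumes \<rho>: "\<And>j. 0 \<le> \<rho> j \<and> \<rho> j < 1"
    and t: "\<And>j. 0 \<le> \<theta> j \<omega> \<and> \<theta> j \<omega> < 2 * pi" and inj: "inj (\<lambda>j. \<theta> j \<omega>)"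
  shows "bij_betw (\<lambda>j. rcis (\<rho> j) (\<theta> j \<omega>)) (distinct_indices \<rho>) (random_points \<rho> \<theta> \<omega>)"
    and "annulus_count (random_points \<rho> \<theta> \<omega>) n = emeasure (count_space UNIV) (level_indices \<rho> n)"
proof -
  let ?z = "\<lambda>j. rcis (\<rho> j) (\<theta> j \<omega>)" and ?J = "distinct_indices \<rho>"
  have inj_z: "inj_on ?z ?J"
  proof (rule inj_onI)
    fix i j assume ij: "i \<in> ?J" "j \<in> ?J" "?z i = ?z j"
    have "\<rho> i = \<rho> j \<and> (\<rho> i = 0 \<or> \<theta> i \<omega> = \<theta> j \<omega>)"
      using ij \<rho> t by (intro rcis_eq_imp) auto
    then consider "\<rho> i = 0" "\<rho> j = 0" | "\<theta> i \<omega> = \<theta> j \<omega>" by metis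
    then show "i = j"
    proof cases
      case 1
      then have "\<not> i < j" "\<not> j < i" using ij(1,2) by (auto simp: distinct_indices_def)
      then show ?thesis by simp
    next
      case 2
      then show ?thesis by (rule injD[OF inj])
    qed
  qed
  have image: "?z ` ?J = random_points \<rho> \<theta> \<omega>"
  proof -
    have "?z j \<in> ?z ` ?J" for j
    proof (cases "j \<in> ?J")
      case False
      then have j: "\<rho> j = 0" by (simp add: distinct_indices_def)
      \<comment> \<open>A discarded index has radius \<open>0\<close> and is represented by the first such index.\<close>
      define i where "i = (LEAST i. \<rho> i = 0)"
      have i: "\<rho> i = 0" unfolding i_def by (rule LeastI[where P = "\<lambda>i. \<rho> i = 0", OF j])
      have "\<rho> l \<noteq> 0" if "l < i" for l using not_less_Least[OF that[unfolded i_def]] by simp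
      then have "i \<in> ?J" by (simp add: distinct_indices_def)
      moreover have "?z j = ?z i" using i j by simp
      ultimately show ?thesis by simp
    qed simp
    then show ?thesis by (auto simp: random_points_def)
  qed
  show "bij_betw ?z ?J (random_points \<rho> \<theta> \<omega>)" using inj_z image by (simp add: bij_betw_def)
  have set: "{w \<in> random_points \<rho> \<theta> \<omega>. 1 - 2 powr (- real n) \<le> cmod w \<and> cmod w < 1 - 2 powr (- real n - 1)}
     = ?z ` level_indices \<rho> n"
  proof -
    let ?P = "\<lambda>w :: complex. 1 - 2 powr (- real n) \<le> cmod w \<and> cmod w < 1 - 2 powr (- real n - 1)"
    have lev: "(1 - 2 powr (- real n) \<le> cmod (?z j) \<and> cmod (?z j) < 1 - 2 powr (- real n - 1)) \<longleftrightarrow> level (\<rho> j) = n" for j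
      using level_eq_iff[of "\<rho> j" n] \<rho>[of j] by simp
    have "{w \<in> ?z ` ?J. ?P w} = ?z ` {j \<in> ?J. ?P (?z j)}" by blast
    then show ?thesis unfolding image[symmetric] level_indices_def by (simp only: lev)
  qed
  have inj_n: "inj_on ?z (level_indices \<rho> n)"
    using inj_z by (rule inj_on_subset) (auto simp: level_indices_def)
  show "annulus_count (random_points \<rho> \<theta> \<omega>) n = emeasure (count_space UNIV) (level_indices \<rho> n)"
    unfolding annulus_count_def set
    using inj_n by (cases "finite (level_indices \<rho> n)") (auto simp: card_image finite_image_iff)
qed

text \<open>
  An infinite level would make its term infinite, since the coefficients are positive; finiteness of
  the sum thus allows the passage from extended to real counts.
\<close>

lemma summable_level_counts:
  fixes I :: "nat \<Rightarrow> nat set"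
  assumes "(\<Sum>n. ennreal (2 powr (- \<beta> * real n)) * emeasure (count_space UNIV) (I n)) < \<infinity>"
  shows "finite (I n)"
    and "(\<Sum>m<n. real (card (I m)) * 2 powr (- \<beta> * real m))
      \<le> enn2real (\<Sum>n. ennreal (2 powr (- \<beta> * real n)) * emeasure (count_space UNIV) (I n))"
proof -
  let ?a = "\<lambda>n. ennreal (2 powr (- \<beta> * real n)) * emeasure (count_space UNIV) (I n)"
  have part: "sum ?a {..<n} \<le> suminf ?a" for n by (intro sum_le_suminf) auto
  show fin: "finite (I n)" for n
  proof (rule ccontr)
    assume "infinite (I n)"
    then have "?a n = \<infinity>" by (simp add: ennreal_mult_top)
    moreover have "?a n \<le> sum ?a {..<Suc n}" by simp
    then have "?a n \<le> suminf ?a" using part by (rule order_trans)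
    then have "?a n < \<infinity>" using assms by (rule le_less_trans)
    ultimately show False by simp
  qed
  have "ennreal (\<Sum>m<n. real (card (I m)) * 2 powr (- \<beta> * real m)) = sum ?a {..<n}"
    using fin by (subst sum_ennreal[symmetric]) (auto simp: ennreal_mult mult.commute ennreal_of_nat_eq_real_of_nat)
  also have "\<dots> \<le> suminf ?a" by (rule part)
  also have "\<dots> = ennreal (enn2real (suminf ?a))" using assms by simp
  finally show "(\<Sum>m<n. real (card (I m)) * 2 powr (- \<beta> * real m)) \<le> enn2real (suminf ?a)"
    by (subst (asm) ennreal_le_iff) auto
qed

theorem theorem1p4:
  fixes M :: "'w measure"
    and \<rho> :: "nat \<Rightarrow> real"
    and \<theta> :: "nat \<Rightarrow> 'w \<Rightarrow> real"
    and \<alpha> :: real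
  assumes "prob_space M"
    and "\<And>k. 0 \<le> \<rho> k \<and> \<rho> k < 1"
    and "prob_space.indep_vars M (\<lambda>_. borel) \<theta> UNIV"
    and "\<And>k. distr M borel (\<theta> k) = uniform_measure lborel {0..2 * pi}"
    and "0 < \<alpha>" and "\<alpha> < 1"
    and "AE \<omega> in M.
      (\<Sum>n. ennreal (2 powr (- (1 - \<alpha>) * real n)) * annulus_count (random_points \<rho> \<theta> \<omega>) n) < \<infinity>"
  shows "AE \<omega> in M. carleson_measure \<alpha> (point_mass_measure \<alpha> (random_points \<rho> \<theta> \<omega>))"
proof -
  interpret prob_space M by (rule assms(1))
  interpret uniform_angles M \<theta> using assms(3,4) by unfold_locales
  define I where "I = level_indices \<rho>"
  define \<epsilon> where "\<epsilon> = min \<alpha> (1 - \<alpha>) / 3"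
  have eps: "0 < \<epsilon>" "3 * \<epsilon> \<le> 1 - \<alpha>" "3 * \<epsilon> \<le> \<alpha>" "\<epsilon> \<le> 1" using assms(5,6) by (auto simp: \<epsilon>_def)
  have "AE \<omega> in M. (\<Sum>n. ennreal (2 powr (- (1 - \<alpha>) * real n)) * emeasure (count_space UNIV) (I n)) < \<infinity>"
    using assms(7) AE_angle_bounds AE_angles_distinct
    by eventually_elim (simp add: random_points_distinct_indices(2)[OF assms(2)] I_def)
  \<comment> \<open>The counts of indices do not depend on \<open>\<omega>\<close>, so almost sure finiteness is finiteness.\<close>
  then have sum_finite: "(\<Sum>n. ennreal (2 powr (- (1 - \<alpha>) * real n)) * emeasure (count_space UNIV) (I n)) < \<infinity>"
    by simp
  have fin: "finite (I n)" for n by (rule summable_level_counts(1)[OF sum_finite])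
  note mass = summable_level_counts(2)[OF sum_finite]
  define T where "T = enn2real (\<Sum>n. ennreal (2 powr (- (1 - \<alpha>) * real n)) * emeasure (count_space UNIV) (I n))"
  from AE_arc_counts_bounded[of I, OF fin eps(1,4)] AE_angle_bounds AE_angles_distinct
  show ?thesis
  proof eventually_elim
    case (elim \<omega>)
    let ?\<Lambda> = "random_points \<rho> \<theta> \<omega>" and ?J = "distinct_indices \<rho>"
    define z where "z j = rcis (\<rho> j) (\<theta> j \<omega>)" for j
    obtain K where K: "K \<ge> 0" and count: "\<And>m k a. k \<le> m \<Longrightarrow> real (card {j\<in>I m. arc_index k (\<theta> j \<omega>) = a})
       \<le> K * (2 powr (\<epsilon> * (real m - real k)) + real (card (I m)) * 2 powr (- (1 - \<epsilon>) * real k))"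
      using elim(1) by blast
    have bij: "bij_betw z ?J ?\<Lambda>"
      unfolding z_def using elim by (intro random_points_distinct_indices(1) assms(2)) auto
    have disc: "?\<Lambda> \<subseteq> unit_disc" using assms(2) by (auto simp: random_points_def)
    have sparse: "sparse_arcs F (\<lambda>j. level (\<rho> j)) (\<lambda>k j. arc_index k (\<theta> j \<omega>)) (\<lambda>n. real (card (I n))) K T (1 - \<alpha>) \<epsilon>"
      if F: "finite F" "F \<subseteq> ?J" for F
    proof
      fix k m a :: nat assume km: "k \<le> m"
      have "card {j\<in>F. level (\<rho> j) = m \<and> arc_index k (\<theta> j \<omega>) = a} \<le> card {j\<in>I m. arc_index k (\<theta> j \<omega>) = a}"
      proof (rule card_mono)
        show "finite {j\<in>I m. arc_index k (\<theta> j \<omega>) = a}" using fin[of m] by simp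
      qed (use F in \<open>auto simp: I_def level_indices_def\<close>)
      then show "real (card {j\<in>F. level (\<rho> j) = m \<and> arc_index k (\<theta> j \<omega>) = a})
         \<le> K * (2 powr (\<epsilon> * (real m - real k)) + real (card (I m)) * 2 powr (- (1 - \<epsilon>) * real k))"
        using count[OF km, of a] by linarith
    qed (use F eps K elim mass in \<open>auto simp: T_def intro: arc_index_less\<close>)
    let ?C = "carleson_const \<alpha> \<epsilon> K T"
    have "(\<integral>\<^sup>+w. ennreal ((cmod (f w))\<^sup>2) \<partial>point_mass_measure \<alpha> ?\<Lambda>) \<le> ennreal ?C * dirichlet_norm_sq \<alpha> f"
      if f: "f \<in> dirichlet_space \<alpha>" for f
    proof -
      let ?g = "\<lambda>w. (1 - (cmod w)\<^sup>2) powr (1 - \<alpha>) * (cmod (f w))\<^sup>2"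
      let ?d = "enn2real (dirichlet_norm_sq \<alpha> f)"
      have "(\<integral>\<^sup>+w. ennreal ((cmod (f w))\<^sup>2) \<partial>point_mass_measure \<alpha> ?\<Lambda>) = (\<integral>\<^sup>+w. ennreal (?g w) \<partial>count_space ?\<Lambda>)"
        using f disc by (intro nn_integral_point_mass_measure) (auto simp: dirichlet_space_def)
      also have "\<dots> = (\<integral>\<^sup>+j. ennreal (?g (z j)) \<partial>count_space ?J)"
        by (rule nn_integral_bij_count_space[OF bij, symmetric])
      also have "\<dots> \<le> ennreal (?C * ?d)"
      proof (rule nn_integral_count_space_le)
        fix F assume F: "finite F" "F \<subseteq> ?J"
        show "(\<Sum>j\<in>F. ?g (z j)) \<le> ?C * ?d"
          using finite_carleson_bound[OF f assms(5,6,2) _ sparse[OF F]] elim(2) by (simp add: z_def)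
      qed simp
      also have "\<dots> = ennreal ?C * ennreal ?d" by (simp add: ennreal_mult'')
      also have "ennreal ?d = dirichlet_norm_sq \<alpha> f"
        using f by (simp add: dirichlet_space_def)
      finally show ?thesis .
    qed
    then show ?case unfolding carleson_measure_def by (auto simp: point_mass_measure_def)
  qed
qed

end
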